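(* Let $p$ be a prime number. The $p$-adic Hahn series $\mathfrak{A} = \sum_{k=1}^\infty p^{-1/p^k} \in W(\overline{\mathbf{F}}_p)((p^{\mathbf{Q}}))$ is transcendental over $\mathbf{Q}_p$.
   Context: Let $W(\overline{\mathbf{F}}_p)$ be the ring of Witt vectors of $\overline{\mathbf{F}}_p$ and $[\cdot]:\overline{\mathbf{F}}_p\to W(\overline{\mathbf{F}}_p)$ the Teichmüller lift. Let $W(\overline{\mathbf{F}}_p)((t^{\mathbf{Q}}))$ be the ring of Hahn series, i.e. formal sums $\sum_{q\in\mathbf{Q}} r_q t^q$ with $r_q\in W(\overline{\mathbf{F}}_p)$ whose support $\{q : r_q\neq 0\}$ is a well-ordered subset of $\mathbf{Q}$, with the usual termwise addition and convolution product. Let $\mathcal{N}$ be the maximal ideal of those $\sum_q r_q t^q$ such that $\sum_{n\in\mathbf{Z}} r_{q+n}p^n=0$ for every $q\in\mathbf{Q}$. The field of $p$-adic Hahn series is $W(\overline{\mathbf{F}}_p)((p^{\mathbf{Q}})) := W(\overline{\mathbf{F}}_p)((t^{\mathbf{Q}}))/\mathcal{N}$; the image of $\sum_q r_q t^q$ is written $\sum_q r_q p^q$ (so the image of $t$ is $p$). Every element has a unique standard expansion $\sum_{q\in\mathbf{Q}}[r_q]p^q$ with $r_q\in\overline{\mathbf{F}}_p$ and with well-ordered support $\{q : r_q\ne 0\}$. This field contains $\breve{\mathbf{Q}}_p = W(\overline{\mathbf{F}}_p)[p^{-1}]$, hence $\mathbf{Q}_p$. The series $\mathfrak{A}$ is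 the image of the Hahn series $\sum_{k\ge1} t^{-1/p^k}$ (it is not the $p$-adic limit of its partial sums). *)

theory Defs
  imports
    "HOL-Algebra.Algebra"
    "HOL-Algebra.Algebraic_Closure_Type"
    "HOL-Library.Poly_Mapping"
    "Berlekamp_Zassenhaus.Finite_Field"
begin

section \<open>Integer polynomials in several variables\<close>

text \<open>Finitely supported maps from exponent vectors to coefficients; the ring operations are those
  of \<^theory>\<open>HOL-Library.Poly_Mapping\<close>.\<close>

type_synonym 'v int_mpoly = "('v \<Rightarrow>\<^sub>0 nat) \<Rightarrow>\<^sub>0 int"

definition mpvar :: "'v \<Rightarrow> 'v int_mpoly" where
  "mpvar v = Poly_Mapping.single (Poly_Mapping.single v 1) 1"

definition mpeval :: "('v \<Rightarrow> 'a::comm_ring_1) \<Rightarrow> 'v int_mpoly \<Rightarrow> 'a" where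
  "mpeval x P = (\<Sum>m\<in>Poly_Mapping.keys P. of_int (Poly_Mapping.lookup P m) *
     (\<Prod>v\<in>Poly_Mapping.keys m. x v ^ Poly_Mapping.lookup m v))"


section \<open>Witt vectors\<close>

definition ghost :: "nat \<Rightarrow> nat \<Rightarrow> (nat \<Rightarrow> 'a::comm_ring_1) \<Rightarrow> 'a" where
  "ghost p n x = (\<Sum>i\<le>n. of_nat (p ^ i) * x i ^ (p ^ (n - i)))"

text \<open>The variable \<open>Inl i\<close> is the \<open>i\<close>-th component of the left operand, \<open>Inr i\<close> that of
  the right operand. Witt's theorem says that for prime \<open>p\<close> the two descriptions below have
  exactly one solution over the integers.\<close>

definition witt_add_polys :: "nat \<Rightarrow> nat \<Rightarrow> (nat + nat) int_mpoly" where
  "witt_add_polys p = (THE S. \<forall>n.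
     ghost p n S = ghost p n (\<lambda>i. mpvar (Inl i)) + ghost p n (\<lambda>i. mpvar (Inr i)))"

definition witt_mult_polys :: "nat \<Rightarrow> nat \<Rightarrow> (nat + nat) int_mpoly" where
  "witt_mult_polys p = (THE P. \<forall>n.
     ghost p n P = ghost p n (\<lambda>i. mpvar (Inl i)) * ghost p n (\<lambda>i. mpvar (Inr i)))"

definition witt_ring :: "nat \<Rightarrow> (nat \<Rightarrow> 'k::comm_ring_1) ring" where
  "witt_ring p =
     \<lparr>carrier = UNIV,
      monoid.mult = (\<lambda>x y n. mpeval (case_sum x y) (witt_mult_polys p n)),
      one = (\<lambda>n. if n = 0 then 1 else 0),
      ring.zero = (\<lambda>n. 0),
      add = (\<lambda>x y n. mpeval (case_sum x y) (witt_add_polys p n))\<rparr>"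

text \<open>Convergence in the \<open>p\<close>-adic topology of a ring \<open>R\<close>.\<close>

definition padic_tendsto ::
    "('a, 'm) ring_scheme \<Rightarrow> nat \<Rightarrow> (nat \<Rightarrow> 'a) \<Rightarrow> 'a \<Rightarrow> bool" where
  "padic_tendsto R p s x \<longleftrightarrow>
     (\<forall>m. \<exists>N. \<forall>n\<ge>N. \<exists>y\<in>carrier R. s n \<ominus>\<^bsub>R\<^esub> x = add_pow R (p ^ m) y)"

text \<open>The copy of \<open>\<int>\<^sub>p\<close> in a \<open>p\<close>-adically complete ring without \<open>p\<close>-torsion, that is, the
  completion of the integers: all limits of sequences of integers.\<close>

definition padic_integers :: "('a, 'm) ring_scheme \<Rightarrow> nat \<Rightarrow> 'a set" where
  "padic_integers R p =
     {x \<in> carrier R. \<exists>a :: nat \<Rightarrow> int. padic_tendsto R p (\<lambda>n. add_pow R (a n) \<one>\<^bsub>R\<^esub>) x}"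


section \<open>Hahn series with rational exponents\<close>

definition hahn_supp :: "('a, 'm) ring_scheme \<Rightarrow> (rat \<Rightarrow> 'a) \<Rightarrow> rat set" where
  "hahn_supp R f = {q. f q \<noteq> \<zero>\<^bsub>R\<^esub>}"

definition well_ordered :: "rat set \<Rightarrow> bool" where
  "well_ordered A \<longleftrightarrow> well_order_on A {(x, y) \<in> A \<times> A. x \<le> y}"

definition hahn_monom :: "('a, 'm) ring_scheme \<Rightarrow> 'a \<Rightarrow> rat \<Rightarrow> rat \<Rightarrow> 'a" where
  "hahn_monom R c a = (\<lambda>q. if q = a then c else \<zero>\<^bsub>R\<^esub>)"

text \<open>The index set of the convolution sum is finite because both supports are well-ordered.\<close>

definition hahn_ring :: "('a, 'm) ring_scheme \<Rightarrow> (rat \<Rightarrow> 'a) ring" where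
  "hahn_ring R =
     \<lparr>carrier = {f. range f \<subseteq> carrier R \<and> well_ordered (hahn_supp R f)},
      monoid.mult = (\<lambda>f g q. \<Oplus>\<^bsub>R\<^esub>a\<in>{a \<in> hahn_supp R f. q - a \<in> hahn_supp R g}. f a \<otimes>\<^bsub>R\<^esub> g (q - a)),
      one = hahn_monom R \<one>\<^bsub>R\<^esub> 0,
      ring.zero = (\<lambda>q. \<zero>\<^bsub>R\<^esub>),
      add = (\<lambda>f g q. f q \<oplus>\<^bsub>R\<^esub> g q)\<rparr>"


section \<open>\<open>p\<close>-adic Hahn series\<close>

text \<open>The condition \<open>\<Sum>n\<in>\<int>. f (q + n) * p ^ n = 0\<close> lives in \<open>R[1/p]\<close>. As the support of \<open>f\<close> is
  well-ordered, there is \<open>k\<close> with \<open>f (q + n) = 0\<close> for all \<open>n < k\<close>; multiplied by the power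
  \<open>p ^ (-k)\<close>, the sum becomes the series over \<open>j = n - k \<ge> 0\<close> in \<open>R\<close> itself.\<close>

definition hahn_null :: "('a, 'm) ring_scheme \<Rightarrow> nat \<Rightarrow> (rat \<Rightarrow> 'a) set" where
  "hahn_null R p =
     {f \<in> carrier (hahn_ring R).
        \<forall>q. \<exists>k :: int.
          (\<forall>n<k. f (q + of_int n) = \<zero>\<^bsub>R\<^esub>) \<and>
          padic_tendsto R p
            (\<lambda>M. \<Oplus>\<^bsub>R\<^esub>j\<in>{..<M}. add_pow R (p ^ j) (f (q + of_int (k + int j)))) \<zero>\<^bsub>R\<^esub>}"

definition padic_hahn :: "('a, 'm) ring_scheme \<Rightarrow> nat \<Rightarrow> (rat \<Rightarrow> 'a) set ring" where
  "padic_hahn R p = hahn_ring R Quot hahn_null R p"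

definition padic_hahn_class ::
    "('a, 'm) ring_scheme \<Rightarrow> nat \<Rightarrow> (rat \<Rightarrow> 'a) \<Rightarrow> (rat \<Rightarrow> 'a) set" where
  "padic_hahn_class R p f = hahn_null R p +>\<^bsub>hahn_ring R\<^esub> f"

text \<open>\<open>\<rat>\<^sub>p = \<int>\<^sub>p[1/p]\<close>: the elements \<open>c * p ^ (-n)\<close>, where \<open>p\<close> is the image of \<open>t\<close>.\<close>

definition padic_rationals :: "('a, 'm) ring_scheme \<Rightarrow> nat \<Rightarrow> (rat \<Rightarrow> 'a) set set" where
  "padic_rationals R p =
     {padic_hahn_class R p (hahn_monom R c (- of_nat n)) | c n. c \<in> padic_integers R p}"

definition hahn_A :: "('a, 'm) ring_scheme \<Rightarrow> nat \<Rightarrow> rat \<Rightarrow> 'a" where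
  "hahn_A R p = (\<lambda>q. if \<exists>k\<ge>1. q = - (1 / of_nat p ^ k) then \<one>\<^bsub>R\<^esub> else \<zero>\<^bsub>R\<^esub>)"

definition padic_A :: "('a, 'm) ring_scheme \<Rightarrow> nat \<Rightarrow> (rat \<Rightarrow> 'a) set" where
  "padic_A R p = padic_hahn_class R p (hahn_A R p)"

end

theory Submission
  imports Defs
begin

text \<open>
  A polynomial relation between the powers of $A = \sum_{k \ge 1} p^{-1/p^k}$ lifts to a Hahn series
  $F = \sum_{i \le d} h_i A^i$ over the Witt vectors \<open>W\<close>, where now $A = \sum_k t^{-1/p^k}$ and the
  $h_i$ have integral exponents. The relation says that \<open>F\<close> is null: on each class \<open>q + \<int>\<close> of
  exponents separately, the sum of the coefficients of \<open>F\<close>, weighted by powers of \<open>p\<close>, is zero.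

  Take the class of $q = -(p^{-1} + p^{-2} + \dots + p^{-d})$. The exponents of $A^i$ are the negatives
  of sums of \<open>i\<close> negative powers of \<open>p\<close>. Modulo the integers, the base-\<open>p\<close> expansion is the
  unique shortest way to write a number as a sum of negative powers of \<open>p\<close>
  (\<open>frac_sum_minimal\<close>). So for \<open>i < d\<close> no exponent of $A^i$ lies in this class, and for
  \<open>i = d\<close> only \<open>q\<close> itself does, with coefficient \<open>d!\<close> (the number of ways to order the \<open>d\<close>
  summands). On this class \<open>F\<close> is therefore a shift of \<open>d! h\<^sub>d\<close>. As \<open>W\<close> has no
  \<open>p\<close>-torsion, the factor \<open>d!\<close> can be removed, so that \<open>h\<^sub>d\<close> itself is null, and induction on \<open>d\<close>
  shows the same for all $h_i$ (\<open>null_if_power_sum_null\<close>). In characteristic \<open>p\<close> this argument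
  breaks down at \<open>d! = 0\<close>, as it must: there the series is a root of an Artin-Schreier polynomial.

  The remaining work justifies the setting. Witt's theorem on the addition and
  multiplication polynomials follows from Dwork's criterion for ghost components (\<open>ex_ghost\<close>); it
  yields that Witt vectors form a commutative ring (\<open>cring_witt_ring\<close>), without \<open>p\<close>-torsion over
  a field of characteristic \<open>p\<close> because $p(x_0, x_1, \dots) = (0, x_0^p, x_1^p, \dots)$ there
  (\<open>witt_p_times\<close>). Hahn series form a ring because sumsets of well-ordered sets are
  well-ordered, and the null series form an ideal in it (\<open>null_hahn_mult\<close>).
\<close>

hide_const (open) Divisibility.prime


section \<open>Integer polynomials as a free commutative ring\<close>

definition monom_eval :: "('v \<Rightarrow> 'a::comm_ring_1) \<Rightarrow> ('v \<Rightarrow>\<^sub>0 nat) \<Rightarrow> 'a" where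
  "monom_eval x m = (\<Prod>v\<in>Poly_Mapping.keys m. x v ^ Poly_Mapping.lookup m v)"

lemma monom_eval_superset:
  assumes "finite V" "Poly_Mapping.keys m \<subseteq> V"
  shows "monom_eval x m = (\<Prod>v\<in>V. x v ^ Poly_Mapping.lookup m v)"
  unfolding monom_eval_def
  by (rule prod.mono_neutral_left) (use assms in \<open>auto simp: in_keys_iff\<close>)

lemma monom_eval_add: "monom_eval x (m + n) = monom_eval x m * monom_eval x n"
proof -
  let ?V = "Poly_Mapping.keys m \<union> Poly_Mapping.keys n"
  have "monom_eval x (m + n) = (\<Prod>v\<in>?V. x v ^ Poly_Mapping.lookup (m + n) v)"
    by (rule monom_eval_superset) (auto simp: in_keys_iff lookup_add)
  also have "\<dots> = monom_eval x m * monom_eval x n"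
    by (simp add: monom_eval_superset[of ?V m] monom_eval_superset[of ?V n] lookup_add
        power_add prod.distrib)
  finally show ?thesis .
qed

lemma monom_eval_0 [simp]: "monom_eval x 0 = 1"
  by (simp add: monom_eval_def)

lemma monom_eval_single [simp]: "monom_eval x (Poly_Mapping.single v n) = x v ^ n"
  by (cases "n = 0") (simp_all add: monom_eval_def)

lemma mpeval_superset:
  assumes "finite M" "Poly_Mapping.keys P \<subseteq> M"
  shows "mpeval x P = (\<Sum>m\<in>M. of_int (Poly_Mapping.lookup P m) * monom_eval x m)"
  unfolding mpeval_def monom_eval_def
  by (rule sum.mono_neutral_left) (use assms in \<open>auto simp: in_keys_iff\<close>)

lemma mpeval_add: "mpeval x (P + Q) = mpeval x P + mpeval x Q"
proof -
  let ?M = "Poly_Mapping.keys P \<union> Poly_Mapping.keys Q"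
  have "mpeval x (P + Q) = (\<Sum>m\<in>?M. of_int (Poly_Mapping.lookup (P + Q) m) * monom_eval x m)"
    by (rule mpeval_superset) (auto simp: in_keys_iff lookup_add)
  also have "\<dots> = mpeval x P + mpeval x Q"
    by (simp add: mpeval_superset[of ?M P] mpeval_superset[of ?M Q] lookup_add
        distrib_right sum.distrib)
  finally show ?thesis .
qed

lemma mpeval_0 [simp]: "mpeval x 0 = 0"
  by (simp add: mpeval_def)

lemma mpeval_sum: "mpeval x (sum f A) = (\<Sum>a\<in>A. mpeval x (f a))"
  by (induction A rule: infinite_finite_induct) (simp_all add: mpeval_add)

lemma mpeval_single: "mpeval x (Poly_Mapping.single m c) = of_int c * monom_eval x m"
  by (subst mpeval_superset[of "{m}"]) simp_all

lemma sum_single_keys: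
  fixes P :: "'a \<Rightarrow>\<^sub>0 'b::comm_monoid_add"
  shows "(\<Sum>m\<in>Poly_Mapping.keys P. Poly_Mapping.single m (Poly_Mapping.lookup P m)) = P"
proof (rule poly_mapping_eqI)
  fix k
  have "(\<Sum>m\<in>Poly_Mapping.keys P. Poly_Mapping.lookup (Poly_Mapping.single m (Poly_Mapping.lookup P m)) k)
      = (\<Sum>m\<in>Poly_Mapping.keys P. if k = m then Poly_Mapping.lookup P m else 0)"
    by (rule sum.cong) (auto simp: lookup_single when_def)
  then show "Poly_Mapping.lookup (\<Sum>m\<in>Poly_Mapping.keys P.
      Poly_Mapping.single m (Poly_Mapping.lookup P m)) k = Poly_Mapping.lookup P k"
    by (simp add: lookup_sum in_keys_iff)
qed

lemma mpeval_mult: "mpeval x (P * Q) = mpeval x P * mpeval x Q"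
proof -
  let ?S = "\<lambda>P. \<Sum>m\<in>Poly_Mapping.keys P. Poly_Mapping.single m (Poly_Mapping.lookup P m)"
  have "mpeval x (?S P * ?S Q) = mpeval x (?S P) * mpeval x (?S Q)"
    by (simp add: sum_product mpeval_sum mult_single mpeval_single monom_eval_add mult_ac)
  then show ?thesis
    by (simp add: sum_single_keys)
qed

lemma mpeval_mpvar [simp]: "mpeval x (mpvar v) = x v"
  by (simp add: mpvar_def mpeval_single)

interpretation mpeval: comm_ring_hom "mpeval x"
  by unfold_locales
    (simp_all add: mpeval_add mpeval_mult mpeval_single flip: single_one)

lemma hom_mpeval:
  assumes "comm_ring_hom h"
  shows "h (mpeval x P) = mpeval (h \<circ> x) P"
proof -
  interpret comm_ring_hom h by fact
  show ?thesis
    by (simp add: mpeval_def hom_distribs)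
qed

lemma monom_eval_mpvar: "monom_eval mpvar m = Poly_Mapping.single m 1"
proof -
  have pow: "mpvar v ^ n = Poly_Mapping.single (Poly_Mapping.single v n) 1" for v :: 'a and n
    by (induction n) (simp_all add: mpvar_def mult_single flip: single_add)
  have prod: "(\<Prod>v\<in>V. Poly_Mapping.single (g v) (1::int)) = Poly_Mapping.single (\<Sum>v\<in>V. g v) 1"
    for V :: "'a set" and g :: "'a \<Rightarrow> 'a \<Rightarrow>\<^sub>0 nat"
    by (induction V rule: infinite_finite_induct) (simp_all add: mult_single)
  show ?thesis
    by (simp add: monom_eval_def pow prod sum_single_keys)
qed

text \<open>Hence the variables generate the ring, which is what the induction principle below exploits.\<close>

lemma mpeval_mpvar_id: "mpeval mpvar P = P"
proof -
  have "mpeval mpvar P = (\<Sum>m\<in>Poly_Mapping.keys P. Poly_Mapping.single m (Poly_Mapping.lookup P m))"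
    unfolding mpeval_def monom_eval_def[symmetric] monom_eval_mpvar
    by (simp add: mult_single flip: single_of_int)
  then show ?thesis by (simp add: sum_single_keys)
qed

lemma int_mpoly_induct [case_names const var add mult]:
  fixes P :: "'v int_mpoly"
  assumes const: "\<And>c. R (of_int c)" and var: "\<And>v. R (mpvar v)"
    and add: "\<And>a b. R a \<Longrightarrow> R b \<Longrightarrow> R (a + b)" and mult: "\<And>a b. R a \<Longrightarrow> R b \<Longrightarrow> R (a * b)"
  shows "R P"
proof -
  have one: "R 1" and zero: "R 0" using const[of 1] const[of 0] by simp_all
  have pow: "R (a ^ n)" if "R a" for a n
    using that by (induction n) (auto intro: one mult)
  have prod: "R (prod f A)" if "\<And>a. a \<in> A \<Longrightarrow> R (f a)" for f :: "'v \<Rightarrow> _" and A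
    using that by (induction A rule: infinite_finite_induct) (auto intro: one mult)
  have sum: "R (sum f A)" if "\<And>a. a \<in> A \<Longrightarrow> R (f a)" for f :: "('v \<Rightarrow>\<^sub>0 nat) \<Rightarrow> _" and A
    using that by (induction A rule: infinite_finite_induct) (auto intro: zero add)
  have "R (mpeval mpvar P)"
    unfolding mpeval_def by (intro sum mult const prod pow var)
  then show ?thesis by (simp add: mpeval_mpvar_id)
qed

text \<open>Absence of torsion makes Witt vectors over this ring determined by their ghost components.\<close>

lemma int_mpoly_mult_cancel:
  fixes a b :: "'v int_mpoly"
  assumes "of_nat n * a = of_nat n * b" "n > 0"
  shows "a = b"
proof (rule poly_mapping_eqI)
  fix k
  have "Poly_Mapping.lookup (of_nat n * c) k = int n * Poly_Mapping.lookup c k" for c :: "'v int_mpoly"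
    by (induction n) (simp_all add: lookup_add algebra_simps)
  with assms show "Poly_Mapping.lookup a k = Poly_Mapping.lookup b k"
    by (metis mult_left_cancel of_nat_0_less_iff less_irrefl)
qed


section \<open>Congruences modulo powers of a prime\<close>

text \<open>In $a^p - b^p = (a - b) \sum_{i<p} a^i b^{p-1-i}$ the second factor is congruent to $p b^{p-1}$,
  so it contributes one more factor \<open>p\<close>.\<close>

lemma pow_cong_step:
  fixes a b :: "'a::comm_ring_1"
  assumes "of_nat p ^ Suc n dvd a - b"
  shows "of_nat p ^ Suc (Suc n) dvd a ^ p - b ^ p"
proof -
  have p: "of_nat p dvd a - b"
    using assms by (metis dvd_mult_left power_Suc)
  have "of_nat p dvd (\<Sum>i<p. b ^ (p - Suc i) * (a ^ i - b ^ i)) + of_nat p * b ^ (p - 1)"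
  proof (rule dvd_add)
    have "of_nat p dvd a ^ i - b ^ i" for i
      unfolding power_diff_sumr2 by (rule dvd_mult2[OF p])
    then show "of_nat p dvd (\<Sum>i<p. b ^ (p - Suc i) * (a ^ i - b ^ i))"
      by (intro dvd_sum dvd_mult)
  qed simp
  also have "(\<Sum>i<p. b ^ (p - Suc i) * (a ^ i - b ^ i)) + of_nat p * b ^ (p - 1)
      = (\<Sum>i<p. b ^ (p - Suc i) * a ^ i)"
  proof -
    have "(\<Sum>i<p. b ^ (p - Suc i) * b ^ i) = (\<Sum>i<p. b ^ (p - 1))"
      by (rule sum.cong) (auto simp flip: power_add)
    then show ?thesis by (simp add: right_diff_distrib sum_subtractf)
  qed
  finally have "of_nat p ^ Suc n * of_nat p dvd (a - b) * (\<Sum>i<p. b ^ (p - Suc i) * a ^ i)"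
    by (intro mult_dvd_mono assms)
  then show ?thesis
    by (simp add: power_diff_sumr2 mult_ac)
qed

lemma pow_cong:
  fixes a b :: "'a::comm_ring_1"
  assumes "of_nat p dvd a - b"
  shows "of_nat p ^ Suc n dvd a ^ (p ^ n) - b ^ (p ^ n)"
proof (induction n)
  case (Suc n)
  show ?case using pow_cong_step[OF Suc] by (simp only: power_Suc2[of p n] power_mult)
qed (use assms in simp)

text \<open>A lift of the Frobenius map: a ring endomorphism that agrees with the \<open>p\<close>-th power
  modulo \<open>p\<close>.\<close>

definition frob :: "nat \<Rightarrow> 'v int_mpoly \<Rightarrow> 'v int_mpoly" where
  "frob p = mpeval (\<lambda>v. mpvar v ^ p)"

interpretation frob: comm_ring_hom "frob p"
  unfolding frob_def by unfold_locales

lemma of_nat_dvd: "m dvd n \<Longrightarrow> (of_nat m :: 'a::comm_semiring_1) dvd of_nat n"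
  by (auto simp: dvd_def)

lemma prime_dvd_freshman:
  fixes a b :: "'a::comm_ring_1"
  assumes "prime p"
  shows "of_nat p dvd (a + b) ^ p - (a ^ p + b ^ p)"
proof -
  have p: "p > 0" using assms prime_gt_0_nat by blast
  have "(a + b) ^ p = (\<Sum>k\<le>p. of_nat (p choose k) * a ^ k * b ^ (p - k))"
    by (rule binomial_ring)
  also have "{..p} = insert 0 (insert p {0<..<p})" using p by auto
  also have "(\<Sum>k\<in>\<dots>. of_nat (p choose k) * a ^ k * b ^ (p - k))
      = b ^ p + a ^ p + (\<Sum>k\<in>{0<..<p}. of_nat (p choose k) * a ^ k * b ^ (p - k))"
    using p by simp
  finally have eq: "(a + b) ^ p - (a ^ p + b ^ p)
      = (\<Sum>k\<in>{0<..<p}. of_nat (p choose k) * a ^ k * b ^ (p - k))" by simp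
  have "p dvd (p choose k)" if "k \<in> {0<..<p}" for k
    using that assms by (intro dvd_choose_prime) auto
  then show ?thesis
    unfolding eq by (intro dvd_sum dvd_mult2) (simp add: of_nat_dvd)
qed

lemma int_fermat:
  assumes p: "prime p"
  shows "int p dvd c ^ p - c"
proof -
  define n where "n = nat (c mod int p)"
  have n: "[c = int n] (mod int p)"
    using prime_gt_0_nat[OF p] by (simp add: n_def cong_def)
  have "[n ^ p = n] (mod p)"
  proof (cases "p dvd n")
    case True
    moreover have "p dvd n ^ p"
      using True prime_gt_0_nat[OF p] by (metis dvd_power dvd_trans)
    ultimately show ?thesis
      by (metis cong_0_iff cong_sym cong_trans)
  next
    case False
    from cong_mult[OF cong_refl[of n] fermat_theorem[OF p False]] show ?thesis
      using prime_gt_0_nat[OF p] by (cases p) simp_all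
  qed
  then have "[int n ^ p = int n] (mod int p)"
    by (metis cong_int_iff of_nat_power)
  then have "[c ^ p = c] (mod int p)"
    using cong_pow[OF n, of p] n by (metis cong_trans cong_sym)
  then show ?thesis by (simp add: cong_iff_dvd_diff)
qed

text \<open>Modulo \<open>p\<close> the \<open>p\<close>-th power is additive, so the elements with this property form a subring;
  it contains the constants by Fermat and the variables by definition.\<close>

lemma frob_cong:
  fixes a :: "'v int_mpoly"
  assumes p: "prime p"
  shows "of_nat p dvd a ^ p - frob p a"
proof (induction a rule: int_mpoly_induct)
  case (const c)
  obtain k where "c ^ p - c = int p * k"
    using int_fermat[OF p] by (auto simp: dvd_def)
  then have "of_int (c ^ p - c) = (of_int (int p * k) :: 'v int_mpoly)"
    by simp
  then show ?case by (simp add: frob.hom_of_int)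
next
  case (var v)
  show ?case by (simp add: frob_def)
next
  case (add a b)
  have "(a + b) ^ p - frob p (a + b)
      = ((a + b) ^ p - (a ^ p + b ^ p)) + ((a ^ p - frob p a) + (b ^ p - frob p b))"
    by (simp add: frob.hom_add)
  then show ?case using add prime_dvd_freshman[OF p, of a b] by (simp only: dvd_add)
next
  case (mult a b)
  have "(a * b) ^ p - frob p (a * b) = (a ^ p - frob p a) * b ^ p + frob p a * (b ^ p - frob p b)"
    by (simp add: frob.hom_mult power_mult_distrib algebra_simps)
  then show ?case using mult by simp
qed


section \<open>Which sequences are ghost sequences\<close>

text \<open>Dwork's criterion: these congruences characterise the sequences of ghost components of Witt
  vectors over the polynomial ring (\<open>ghost_seq_ghost\<close>, \<open>ex_ghost\<close>). Unlike the
  components themselves, the congruences are visibly stable under the ring operations, and this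
  is why sums and products of Witt vectors are given by polynomials with integer coefficients.\<close>

definition ghost_seq :: "nat \<Rightarrow> (nat \<Rightarrow> 'v int_mpoly) \<Rightarrow> bool" where
  "ghost_seq p g \<longleftrightarrow> (\<forall>n. of_nat p ^ Suc n dvd g (Suc n) - frob p (g n))"

lemma ghost_seq_add: "ghost_seq p g \<Longrightarrow> ghost_seq p h \<Longrightarrow> ghost_seq p (\<lambda>n. g n + h n)"
  unfolding ghost_seq_def frob.hom_add add_diff_add by (intro allI dvd_add; erule spec)

lemma ghost_seq_uminus: "ghost_seq p g \<Longrightarrow> ghost_seq p (\<lambda>n. - g n)"
  unfolding ghost_seq_def frob.hom_uminus minus_diff_minus dvd_minus_iff .

lemma ghost_seq_mult:
  assumes "ghost_seq p g" "ghost_seq p h"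
  shows "ghost_seq p (\<lambda>n. g n * h n)"
  unfolding ghost_seq_def
proof
  fix n
  have "g (Suc n) * h (Suc n) - frob p (g n * h n)
      = (g (Suc n) - frob p (g n)) * h (Suc n) + frob p (g n) * (h (Suc n) - frob p (h n))"
    by (simp add: frob.hom_mult algebra_simps)
  moreover have "of_nat p ^ Suc n dvd g (Suc n) - frob p (g n)"
    and "of_nat p ^ Suc n dvd h (Suc n) - frob p (h n)"
    using assms unfolding ghost_seq_def by blast+
  ultimately show "of_nat p ^ Suc n dvd g (Suc n) * h (Suc n) - frob p (g n * h n)"
    by (simp only: dvd_add dvd_mult dvd_mult2)
qed

text \<open>The \<open>i\<close>-th summand of the ghost component carries the factor $p^i$, while raising
  $x_i^p \equiv \varphi(x_i)$ to the power $p^{n-i}$ improves the congruence to the modulus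
  $p^{n-i+1}$.\<close>

lemma frob_ghost_cong:
  assumes p: "prime p"
  shows "of_nat p ^ Suc n dvd (\<Sum>i\<le>n. of_nat (p ^ i) * x i ^ (p ^ (Suc n - i))) - frob p (ghost p n x)"
proof -
  have "of_nat p ^ Suc n dvd of_nat (p ^ i) * (x i ^ (p ^ (Suc n - i)) - frob p (x i) ^ (p ^ (n - i)))"
    if "i \<le> n" for i
  proof -
    have "of_nat p ^ Suc (n - i) dvd (x i ^ p) ^ (p ^ (n - i)) - frob p (x i) ^ (p ^ (n - i))"
      by (intro pow_cong frob_cong p)
    then have "of_nat p ^ i * of_nat p ^ Suc (n - i)
        dvd of_nat (p ^ i) * ((x i ^ p) ^ (p ^ (n - i)) - frob p (x i) ^ (p ^ (n - i)))"
      by (intro mult_dvd_mono) simp_all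
    moreover have "(of_nat p ^ i * of_nat p ^ Suc (n - i) :: 'a int_mpoly) = of_nat p ^ Suc n"
      using that by (simp only: flip: power_add) simp
    moreover have "(x i ^ p) ^ (p ^ (n - i)) = x i ^ (p ^ (Suc n - i))"
      using that by (simp add: Suc_diff_le flip: power_mult)
    ultimately show ?thesis by simp
  qed
  then have "of_nat p ^ Suc n dvd
      (\<Sum>i\<le>n. of_nat (p ^ i) * (x i ^ (p ^ (Suc n - i)) - frob p (x i) ^ (p ^ (n - i))))"
    by (intro dvd_sum) simp
  then show ?thesis
    by (simp add: ghost_def frob.hom_sum frob.hom_mult frob.hom_power frob.hom_of_nat
        right_diff_distrib sum_subtractf)
qed

lemma ghost_split:
  "ghost p n x = (\<Sum>i<n. of_nat (p ^ i) * x i ^ (p ^ (n - i))) + of_nat (p ^ n) * x n"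
  by (simp add: ghost_def flip: lessThan_Suc_atMost)

lemma ghost_seq_ghost:
  assumes "prime p"
  shows "ghost_seq p (\<lambda>n. ghost p n x)"
  unfolding ghost_seq_def
proof
  fix n
  have "ghost p (Suc n) x - frob p (ghost p n x)
      = ((\<Sum>i\<le>n. of_nat (p ^ i) * x i ^ (p ^ (Suc n - i))) - frob p (ghost p n x))
        + of_nat p ^ Suc n * x (Suc n)"
    by (simp add: ghost_split[of p "Suc n"] lessThan_Suc_atMost)
  then show "of_nat p ^ Suc n dvd ghost p (Suc n) x - frob p (ghost p n x)"
    using frob_ghost_cong[OF assms, of n x] by (simp only: dvd_add dvd_triv_left)
qed

text \<open>The components are found one after the other: the congruence for \<open>g\<close> and
  \<open>frob_ghost_cong\<close> together say that what remains for the \<open>n\<close>-th component is divisible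
  by $p^n$.\<close>

lemma ex_ghost:
  fixes g :: "nat \<Rightarrow> 'v int_mpoly"
  assumes p: "prime p" and g: "ghost_seq p g"
  shows "\<exists>x. \<forall>n. ghost p n x = g n"
proof -
  let ?s = "\<lambda>x n. \<Sum>i<n. of_nat (p ^ i) * x i ^ (p ^ (n - i)) :: 'v int_mpoly"
  have "\<exists>x :: nat \<Rightarrow> 'v int_mpoly. \<forall>n. ?s x n + of_nat (p ^ n) * x n = g n"
  proof (rule dependent_wellorder_choice)
    fix r :: "'v int_mpoly" and f f' :: "nat \<Rightarrow> 'v int_mpoly" and n
    assume "\<And>y. y < n \<Longrightarrow> f y = f' y"
    then have "?s f n = ?s f' n" by (intro sum.cong) simp_all
    then show "?s f n + of_nat (p ^ n) * r = g n \<longleftrightarrow> ?s f' n + of_nat (p ^ n) * r = g n"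
      by simp
  next
    fix n f
    assume f: "\<And>y. y < n \<Longrightarrow> ?s f y + of_nat (p ^ y) * f y = g y"
    have "of_nat (p ^ n) dvd g n - ?s f n"
    proof (cases n)
      case (Suc m)
      have gm: "g m = ghost p m f"
        using f[of m] Suc by (simp add: ghost_split)
      have "g n - ?s f n = (g (Suc m) - frob p (g m)) - (?s f (Suc m) - frob p (g m))"
        by (simp add: Suc)
      moreover have "of_nat p ^ Suc m dvd ?s f (Suc m) - frob p (g m)"
        using frob_ghost_cong[OF p, of m f] by (simp add: gm lessThan_Suc_atMost)
      moreover have "of_nat p ^ Suc m dvd g (Suc m) - frob p (g m)"
        using g unfolding ghost_seq_def by blast
      ultimately show ?thesis
        by (simp only: Suc of_nat_power dvd_diff)
    qed simp
    then obtain r where "g n - ?s f n = of_nat (p ^ n) * r" by (rule dvdE)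
    then have "?s f n + of_nat (p ^ n) * r = g n"
      by (simp only: diff_eq_eq add.commute)
    then show "\<exists>r. ?s f n + of_nat (p ^ n) * r = g n" ..
  qed
  then show ?thesis by (simp only: ghost_split)
qed

lemma ghost_inject:
  fixes x y :: "nat \<Rightarrow> 'v int_mpoly"
  assumes "p > 0" and eq: "\<And>n. ghost p n x = ghost p n y"
  shows "x = y"
proof
  fix n
  show "x n = y n"
  proof (induction n rule: less_induct)
    case (less n)
    then have "of_nat (p ^ n) * x n = of_nat (p ^ n) * y n"
      using eq[of n] by (simp add: ghost_split)
    then show ?case using int_mpoly_mult_cancel[of "p ^ n"] assms(1) by simp
  qed
qed


section \<open>The ring of Witt vectors\<close>

lemma hom_ghost:
  assumes "comm_ring_hom h"
  shows "h (ghost p n x) = ghost p n (h \<circ> x)"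
proof -
  interpret comm_ring_hom h by fact
  show ?thesis by (simp add: ghost_def hom_distribs)
qed

lemma ex1_ghost:
  fixes g :: "nat \<Rightarrow> 'v int_mpoly"
  assumes "prime p" "ghost_seq p g"
  shows "\<exists>!x. \<forall>n. ghost p n x = g n"
proof -
  obtain x where "\<forall>n. ghost p n x = g n" using ex_ghost[OF assms] by blast
  moreover have "y = x" if "\<forall>n. ghost p n y = g n" for y
    using calculation that by (intro ghost_inject[of p] prime_gt_0_nat[OF assms(1)]) simp
  ultimately show ?thesis by blast
qed

text \<open>The defining descriptions of the addition and multiplication polynomials have unique solutions.\<close>

lemma ghost_witt_add_polys:
  assumes "prime p"
  shows "ghost p n (witt_add_polys p)
    = ghost p n (\<lambda>i. mpvar (Inl i)) + ghost p n (\<lambda>i. mpvar (Inr i))"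
  using theI'[OF ex1_ghost[OF assms ghost_seq_add[OF ghost_seq_ghost[OF assms] ghost_seq_ghost[OF assms]]]]
  unfolding witt_add_polys_def by blast

lemma ghost_witt_mult_polys:
  assumes "prime p"
  shows "ghost p n (witt_mult_polys p)
    = ghost p n (\<lambda>i. mpvar (Inl i)) * ghost p n (\<lambda>i. mpvar (Inr i))"
  using theI'[OF ex1_ghost[OF assms ghost_seq_mult[OF ghost_seq_ghost[OF assms] ghost_seq_ghost[OF assms]]]]
  unfolding witt_mult_polys_def by blast

lemma witt_add_eq: "x \<oplus>\<^bsub>witt_ring p\<^esub> y = mpeval (case_sum x y) \<circ> witt_add_polys p"
  and witt_mult_eq: "x \<otimes>\<^bsub>witt_ring p\<^esub> y = mpeval (case_sum x y) \<circ> witt_mult_polys p"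
  and witt_carrier [simp]: "carrier (witt_ring p) = UNIV"
  and witt_zero_eq: "\<zero>\<^bsub>witt_ring p\<^esub> = (\<lambda>n. 0)"
  and witt_one_eq: "\<one>\<^bsub>witt_ring p\<^esub> = (\<lambda>n. if n = 0 then 1 else 0)"
  by (simp_all add: witt_ring_def fun_eq_iff)

lemma mpeval_case_sum:
  "mpeval (case_sum x y) \<circ> (\<lambda>i. mpvar (Inl i)) = x"
  "mpeval (case_sum x y) \<circ> (\<lambda>i. mpvar (Inr i)) = y"
  by (simp_all add: fun_eq_iff)

lemma ghost_witt_add:
  assumes "prime p"
  shows "ghost p n (x \<oplus>\<^bsub>witt_ring p\<^esub> y) = ghost p n x + ghost p n y"
  unfolding witt_add_eq hom_ghost[OF mpeval.comm_ring_hom_axioms, symmetric]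
    ghost_witt_add_polys[OF assms] mpeval.hom_add
  unfolding hom_ghost[OF mpeval.comm_ring_hom_axioms] mpeval_case_sum ..

lemma ghost_witt_mult:
  assumes "prime p"
  shows "ghost p n (x \<otimes>\<^bsub>witt_ring p\<^esub> y) = ghost p n x * ghost p n y"
  unfolding witt_mult_eq hom_ghost[OF mpeval.comm_ring_hom_axioms, symmetric]
    ghost_witt_mult_polys[OF assms] mpeval.hom_mult
  unfolding hom_ghost[OF mpeval.comm_ring_hom_axioms] mpeval_case_sum ..

lemma ghost_witt_zero: "prime p \<Longrightarrow> ghost p n \<zero>\<^bsub>witt_ring p\<^esub> = 0"
  by (auto simp: ghost_def witt_zero_eq power_0_left dest: prime_gt_0_nat)

lemma ghost_witt_one:
  assumes "prime p"
  shows "ghost p n \<one>\<^bsub>witt_ring p\<^esub> = 1"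
proof -
  have "ghost p n \<one>\<^bsub>witt_ring p\<^esub> = (\<Sum>i\<le>n. if i = 0 then 1 else 0 :: 'a)"
    unfolding ghost_def witt_one_eq
    using prime_gt_0_nat[OF assms] by (intro sum.cong) (auto simp: power_0_left)
  then show ?thesis by simp
qed

lemma hom_witt_add:
  "comm_ring_hom h \<Longrightarrow> h \<circ> (x \<oplus>\<^bsub>witt_ring p\<^esub> y) = (h \<circ> x) \<oplus>\<^bsub>witt_ring p\<^esub> (h \<circ> y)"
  by (simp add: witt_add_eq fun_eq_iff hom_mpeval o_case_sum)

lemma hom_witt_mult:
  "comm_ring_hom h \<Longrightarrow> h \<circ> (x \<otimes>\<^bsub>witt_ring p\<^esub> y) = (h \<circ> x) \<otimes>\<^bsub>witt_ring p\<^esub> (h \<circ> y)"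
  by (simp add: witt_mult_eq fun_eq_iff hom_mpeval o_case_sum)

lemma hom_witt_zero:
  assumes "comm_ring_hom h" shows "h \<circ> \<zero>\<^bsub>witt_ring p\<^esub> = \<zero>\<^bsub>witt_ring p\<^esub>"
proof -
  interpret comm_ring_hom h by fact
  show ?thesis by (simp add: witt_zero_eq fun_eq_iff)
qed

lemma hom_witt_one:
  assumes "comm_ring_hom h" shows "h \<circ> \<one>\<^bsub>witt_ring p\<^esub> = \<one>\<^bsub>witt_ring p\<^esub>"
proof -
  interpret comm_ring_hom h by fact
  show ?thesis by (simp add: witt_one_eq fun_eq_iff)
qed

text \<open>Every ring is a quotient of the polynomial ring on its own elements: each element is the
  image of the variable it names.\<close>

lemma mpeval_id_lift: "mpeval id \<circ> (mpvar \<circ> x) = x"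
  by (simp add: fun_eq_iff)

text \<open>Witt vectors over a polynomial ring embed, by their ghost components, into a product of
  copies of that ring, so they satisfy the ring axioms. Evaluation at the named elements carries
  the axioms over to an arbitrary coefficient ring.\<close>

lemma cring_witt_ring:
  assumes p: "prime p"
  shows "cring (witt_ring p :: (nat \<Rightarrow> 'a::comm_ring_1) ring)"
proof -
  let ?W = "witt_ring p :: (nat \<Rightarrow> 'a) ring"
  let ?U = "witt_ring p :: (nat \<Rightarrow> 'a int_mpoly) ring"
  let ?h = "\<lambda>u :: nat \<Rightarrow> 'a int_mpoly. mpeval id \<circ> u"
  note inj = ghost_inject[OF prime_gt_0_nat[OF p]]
  note ghost = ghost_witt_add[OF p] ghost_witt_mult[OF p] ghost_witt_zero[OF p] ghost_witt_one[OF p]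
  note homs = mpeval.comm_ring_hom_axioms[of id]
  note h = hom_witt_add[OF homs] hom_witt_mult[OF homs] hom_witt_zero[OF homs] hom_witt_one[OF homs]
    mpeval_id_lift
  have "u \<oplus>\<^bsub>?U\<^esub> v \<oplus>\<^bsub>?U\<^esub> w = u \<oplus>\<^bsub>?U\<^esub> (v \<oplus>\<^bsub>?U\<^esub> w)" for u v w
    by (rule inj) (simp add: ghost add.assoc)
  from arg_cong[OF this, of ?h "mpvar \<circ> x" "mpvar \<circ> y" "mpvar \<circ> z" for x y z]
  have a1: "x \<oplus>\<^bsub>?W\<^esub> y \<oplus>\<^bsub>?W\<^esub> z = x \<oplus>\<^bsub>?W\<^esub> (y \<oplus>\<^bsub>?W\<^esub> z)" for x y z
    unfolding h .
  have "u \<oplus>\<^bsub>?U\<^esub> v = v \<oplus>\<^bsub>?U\<^esub> u" for u v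
    by (rule inj) (simp add: ghost add.commute)
  from arg_cong[OF this, of ?h "mpvar \<circ> x" "mpvar \<circ> y" for x y]
  have a2: "x \<oplus>\<^bsub>?W\<^esub> y = y \<oplus>\<^bsub>?W\<^esub> x" for x y
    unfolding h .
  have "\<zero>\<^bsub>?U\<^esub> \<oplus>\<^bsub>?U\<^esub> u = u" for u
    by (rule inj) (simp add: ghost)
  from arg_cong[OF this, of ?h "mpvar \<circ> x" for x]
  have a3: "\<zero>\<^bsub>?W\<^esub> \<oplus>\<^bsub>?W\<^esub> x = x" for x
    unfolding h .
  have a4: "\<exists>y. y \<oplus>\<^bsub>?W\<^esub> x = \<zero>\<^bsub>?W\<^esub>" for x
  proof -
    \<comment> \<open>Dwork's criterion supplies the Witt vector with negated ghost components.\<close>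
    obtain v where v: "\<And>n. ghost p n v = - ghost p n (mpvar \<circ> x)"
      using ex_ghost[OF p ghost_seq_uminus[OF ghost_seq_ghost[OF p]]] by blast
    have "v \<oplus>\<^bsub>?U\<^esub> (mpvar \<circ> x) = \<zero>\<^bsub>?U\<^esub>"
      by (rule inj) (simp add: ghost v)
    from arg_cong[OF this, of ?h] show ?thesis
      unfolding h by blast
  qed
  have "u \<otimes>\<^bsub>?U\<^esub> v \<otimes>\<^bsub>?U\<^esub> w = u \<otimes>\<^bsub>?U\<^esub> (v \<otimes>\<^bsub>?U\<^esub> w)" for u v w
    by (rule inj) (simp add: ghost mult.assoc)
  from arg_cong[OF this, of ?h "mpvar \<circ> x" "mpvar \<circ> y" "mpvar \<circ> z" for x y z]
  have m1: "x \<otimes>\<^bsub>?W\<^esub> y \<otimes>\<^bsub>?W\<^esub> z = x \<otimes>\<^bsub>?W\<^esub> (y \<otimes>\<^bsub>?W\<^esub> z)" for x y z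
    unfolding h .
  have "u \<otimes>\<^bsub>?U\<^esub> v = v \<otimes>\<^bsub>?U\<^esub> u" for u v
    by (rule inj) (simp add: ghost mult.commute)
  from arg_cong[OF this, of ?h "mpvar \<circ> x" "mpvar \<circ> y" for x y]
  have m2: "x \<otimes>\<^bsub>?W\<^esub> y = y \<otimes>\<^bsub>?W\<^esub> x" for x y
    unfolding h .
  have "\<one>\<^bsub>?U\<^esub> \<otimes>\<^bsub>?U\<^esub> u = u" for u
    by (rule inj) (simp add: ghost)
  from arg_cong[OF this, of ?h "mpvar \<circ> x" for x]
  have m3: "\<one>\<^bsub>?W\<^esub> \<otimes>\<^bsub>?W\<^esub> x = x" for x
    unfolding h .
  have "(u \<oplus>\<^bsub>?U\<^esub> v) \<otimes>\<^bsub>?U\<^esub> w = (u \<otimes>\<^bsub>?U\<^esub> w) \<oplus>\<^bsub>?U\<^esub> (v \<otimes>\<^bsub>?U\<^esub> w)" for u v w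
    by (rule inj) (simp add: ghost distrib_right)
  from arg_cong[OF this, of ?h "mpvar \<circ> x" "mpvar \<circ> y" "mpvar \<circ> z" for x y z]
  have d: "(x \<oplus>\<^bsub>?W\<^esub> y) \<otimes>\<^bsub>?W\<^esub> z = (x \<otimes>\<^bsub>?W\<^esub> z) \<oplus>\<^bsub>?W\<^esub> (y \<otimes>\<^bsub>?W\<^esub> z)" for x y z
    unfolding h .
  show ?thesis
  proof (rule cringI)
    show "abelian_group ?W"
      by (rule abelian_groupI) (use a1 a2 a3 a4 in auto)
    show "comm_monoid ?W"
      by (rule comm_monoidI) (use m1 m2 m3 in auto)
  qed (use d in auto)
qed

text \<open>A refinement of \<open>ghost_inject\<close> modulo \<open>p\<close>.\<close>

lemma ghost_cong_imp_cong:
  fixes x y :: "nat \<Rightarrow> 'v int_mpoly"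
  assumes p: "prime p" and eq: "\<And>n. of_nat p ^ Suc n dvd ghost p n x - ghost p n y"
  shows "of_nat p dvd x n - y n"
proof (induction n rule: less_induct)
  case (less n)
  have "of_nat p ^ Suc n dvd of_nat (p ^ i) * (x i ^ (p ^ (n - i)) - y i ^ (p ^ (n - i)))"
    if "i < n" for i
  proof -
    have "of_nat p ^ i * of_nat p ^ Suc (n - i) dvd of_nat (p ^ i) * (x i ^ (p ^ (n - i)) - y i ^ (p ^ (n - i)))"
      by (intro mult_dvd_mono pow_cong less that) simp
    moreover have "(of_nat p ^ i * of_nat p ^ Suc (n - i) :: 'v int_mpoly) = of_nat p ^ Suc n"
      using that by (simp only: flip: power_add) simp
    ultimately show ?thesis by simp
  qed
  then have "of_nat p ^ Suc n dvd
      (ghost p n x - ghost p n y) - (\<Sum>i<n. of_nat (p ^ i) * (x i ^ (p ^ (n - i)) - y i ^ (p ^ (n - i))))"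
    by (intro dvd_diff dvd_sum eq) simp
  also have "\<dots> = of_nat p ^ n * (x n - y n)"
    by (simp add: ghost_split algebra_simps sum_subtractf)
  finally obtain k where "of_nat p ^ n * (x n - y n) = of_nat p ^ Suc n * k" ..
  then have "of_nat (p ^ n) * (x n - y n) = of_nat (p ^ n) * (of_nat p * k)"
    by (simp add: mult_ac)
  from int_mpoly_mult_cancel[OF this] show ?case
    using prime_gt_0_nat[OF p] by simp
qed

text \<open>This is the identity $p = VF$ in characteristic \<open>p\<close>. Over the polynomial ring the ghost
  components of $p x$ and of $(0, x_0^p, x_1^p, \dots)$ differ only by multiples of $p^{n+1}$,
  so the two Witt vectors have congruent components modulo \<open>p\<close>. It is needed because it shows
  that multiplication by \<open>p\<close> is injective on Witt vectors over a field.\<close>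

lemma witt_p_times:
  fixes x :: "nat \<Rightarrow> 'a::comm_ring_1"
  assumes p: "prime p" and char: "of_nat p = (0 :: 'a)"
  shows "add_pow (witt_ring p) p x (Suc n) = x n ^ p"
proof -
  let ?U = "witt_ring p :: (nat \<Rightarrow> 'a int_mpoly) ring"
  let ?W = "witt_ring p :: (nat \<Rightarrow> 'a) ring"
  interpret U: cring ?U by (rule cring_witt_ring[OF p])
  interpret W: cring ?W by (rule cring_witt_ring[OF p])
  define u where "u = mpvar \<circ> x"
  \<comment> \<open>The Verschiebung of the componentwise \<open>p\<close>-th power.\<close>
  define V where "V = (\<lambda>n. if n = 0 then 0 else u (n - 1) ^ p)"
  have gU: "ghost p n (add_pow ?U k u) = of_nat k * ghost p n u" for k n
    by (induction k) (simp_all add: add_pow_def ghost_witt_zero[OF p] ghost_witt_add[OF p] algebra_simps)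
  have hU: "mpeval id \<circ> add_pow ?U k u = add_pow ?W k x" for k :: nat
  proof (induction k)
    case 0
    show ?case
      by (simp only: U.add.nat_pow_0 W.add.nat_pow_0 hom_witt_zero[OF mpeval.comm_ring_hom_axioms])
  next
    case (Suc k)
    then show ?case
      by (simp only: U.add.nat_pow_Suc W.add.nat_pow_Suc u_def mpeval_id_lift
          hom_witt_add[OF mpeval.comm_ring_hom_axioms])
  qed
  have gV: "ghost p n (add_pow ?U p u) - ghost p n V = of_nat p ^ Suc n * u n" for n
  proof (cases n)
    case 0
    then show ?thesis by (simp add: gU) (simp add: ghost_def V_def)
  next
    case (Suc m)
    have "ghost p n V = (\<Sum>i\<le>Suc m. of_nat (p ^ i) * V i ^ (p ^ (Suc m - i)))"
      by (simp add: ghost_def Suc)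
    also have "\<dots> = (\<Sum>i\<le>m. of_nat (p ^ Suc i) * V (Suc i) ^ (p ^ (m - i)))"
      using prime_gt_0_nat[OF p] by (subst sum.atMost_Suc_shift) (simp add: V_def power_0_left)
    also have "\<dots> = (\<Sum>i\<le>m. of_nat p * (of_nat (p ^ i) * u i ^ (p ^ (Suc m - i))))"
      by (rule sum.cong) (auto simp: V_def Suc_diff_le mult_ac simp flip: power_mult)
    finally have "ghost p n V = of_nat p * (\<Sum>i<n. of_nat (p ^ i) * u i ^ (p ^ (n - i)))"
      by (simp add: Suc sum_distrib_left lessThan_Suc_atMost)
    then show ?thesis
      by (simp add: gU ghost_split[of p n u] algebra_simps)
  qed
  have "of_nat p dvd add_pow ?U p u (Suc n) - V (Suc n)"
    by (rule ghost_cong_imp_cong[OF p]) (simp only: gV dvd_triv_left)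
  then obtain k where "add_pow ?U p u (Suc n) - V (Suc n) = of_nat p * k" ..
  from arg_cong[OF this, of "mpeval id"]
  have "(mpeval id \<circ> add_pow ?U p u) (Suc n) = mpeval id (V (Suc n))"
    by (simp add: mpeval.hom_minus mpeval.hom_mult mpeval.hom_of_nat char)
  then show ?thesis
    unfolding hU by (simp add: V_def u_def mpeval.hom_power)
qed


section \<open>Well-ordered sets of rational numbers\<close>

text \<open>Descending sequences are the handiest form of well-orderedness for the sumset arguments.\<close>

lemma well_ordered_iff_no_descent:
  "well_ordered A \<longleftrightarrow> \<not> (\<exists>f :: nat \<Rightarrow> rat. \<forall>i. f i \<in> A \<and> f (Suc i) < f i)"
proof -
  have "well_ordered A \<longleftrightarrow> wf {(x, y). x \<in> A \<and> y \<in> A \<and> x < y}"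
  proof -
    have "{(x, y) \<in> A \<times> A. x \<le> y} - Id = {(x, y). x \<in> A \<and> y \<in> A \<and> x < y}"
      by auto
    moreover have "linear_order_on A {(x, y) \<in> A \<times> A. x \<le> y}"
      unfolding linear_order_on_def partial_order_on_def preorder_on_def
    proof (intro conjI)
      show "refl_on A {(x, y) \<in> A \<times> A. x \<le> y}" by (auto simp: refl_on_def)
      show "trans {(x, y) \<in> A \<times> A. x \<le> y}" by (rule transI) auto
      show "antisym {(x, y) \<in> A \<times> A. x \<le> y}" by (rule antisymI) auto
      show "total_on A {(x, y) \<in> A \<times> A. x \<le> y}" by (auto simp: total_on_def)
    qed auto
    ultimately show ?thesis
      by (simp add: well_ordered_def well_order_on_def)
  qed
  also have "\<dots> \<longleftrightarrow> \<not> (\<exists>f :: nat \<Rightarrow> rat. \<forall>i. f i \<in> A \<and> f (Suc i) < f i)"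
    unfolding wf_iff_no_infinite_down_chain by auto
  finally show ?thesis .
qed

lemma well_ordered_no_descent:
  assumes "well_ordered A" "\<And>i :: nat. f i \<in> A" "\<And>i. f (Suc i) < f i"
  shows False
  using assms unfolding well_ordered_iff_no_descent by blast

lemma well_ordered_subset: "well_ordered B \<Longrightarrow> A \<subseteq> B \<Longrightarrow> well_ordered A"
  unfolding well_ordered_iff_no_descent by blast

lemma well_ordered_finite: "finite A \<Longrightarrow> well_ordered A"
  unfolding well_ordered_iff_no_descent
proof
  assume A: "finite A" "\<exists>f :: nat \<Rightarrow> rat. \<forall>i. f i \<in> A \<and> f (Suc i) < f i"
  then obtain f :: "nat \<Rightarrow> rat" where f: "\<And>i. f i \<in> A" "\<And>i. f (Suc i) < f i" by blast
  have "strict_mono (\<lambda>i. - f i)" by (simp add: strict_mono_Suc_iff f)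
  then have "inj (\<lambda>i. - f i)" by (rule strict_mono_imp_inj_on)
  then have "inj f" by (simp add: inj_on_def)
  moreover have "range f \<subseteq> A" using f(1) by auto
  ultimately show False
    using A(1) finite_imageD finite_subset infinite_UNIV_nat by blast
qed

lemma well_ordered_bounded_below:
  assumes "well_ordered A"
  shows "\<exists>b. \<forall>x\<in>A. b \<le> x"
proof (rule ccontr)
  assume "\<not> ?thesis"
  then have *: "\<exists>x\<in>A. x < b" for b by (meson not_le)
  then obtain below where below: "\<And>b. below b \<in> A" "\<And>b. below b < b" by metis
  show False
    by (rule well_ordered_no_descent[OF assms, of "\<lambda>i. (below ^^ Suc i) 0"])
      (simp_all add: below)
qed

text \<open>Every sequence has a monotone subsequence; if that one decreases, it is eventually constant.\<close>

lemma well_ordered_monoseq_incseq: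
  fixes a :: "nat \<Rightarrow> rat"
  assumes A: "well_ordered A" and a: "\<And>i. a i \<in> A"
  shows "\<exists>g. strict_mono g \<and> incseq (a \<circ> g)"
proof -
  obtain g where g: "strict_mono (g :: nat \<Rightarrow> nat)" "monoseq (\<lambda>n. a (g n))"
    using seq_monosub by blast
  show ?thesis
  proof (cases "incseq (a \<circ> g)")
    case False
    then have dec: "decseq (\<lambda>n. a (g n))"
      using g(2) by (simp add: monoseq_iff comp_def)
    have "\<exists>n. \<forall>m\<ge>n. a (g m) = a (g n)"
    proof (rule ccontr)
      assume "\<not> ?thesis"
      then have *: "\<exists>m\<ge>n. a (g m) < a (g n)" for n
        using dec by (metis decseqD order_le_imp_less_or_eq)
      then have "\<exists>m. a (g m) < a (g n)" for n by blast
      then obtain next_index where "\<And>n. a (g (next_index n)) < a (g n)" by metis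
      then show False
        by (intro well_ordered_no_descent[OF A, of "\<lambda>i. a (g ((next_index ^^ i) 0))"]) (simp_all add: a)
    qed
    then obtain n where n: "\<And>m. m \<ge> n \<Longrightarrow> a (g m) = a (g n)" by blast
    have "a \<circ> (\<lambda>i. g (n + i)) = (\<lambda>i. a (g n))"
      using n[OF le_add1] by (simp add: fun_eq_iff)
    then have "incseq (a \<circ> (\<lambda>i. g (n + i)))"
      by (simp add: incseq_def)
    moreover have "strict_mono (\<lambda>i. g (n + i))"
      using g(1) by (auto simp: strict_mono_def)
    ultimately show ?thesis by blast
  qed (use g in blast)
qed

lemma descent_less:
  fixes f :: "nat \<Rightarrow> rat"
  assumes "\<And>i. f (Suc i) < f i" "i < j"
  shows "f j < f i"
  using lift_Suc_mono_less[of "\<lambda>i. - f i", OF _ assms(2)] assms(1) by simp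

text \<open>Along a subsequence on which the first summands increase, a descent of the sums forces a
  descent of the second summands.\<close>

lemma well_ordered_sumset:
  assumes A: "well_ordered A" and B: "well_ordered B"
  shows "well_ordered {a + b | a b. a \<in> A \<and> b \<in> B}"
  unfolding well_ordered_iff_no_descent
proof
  assume "\<exists>f :: nat \<Rightarrow> rat. \<forall>i. f i \<in> {a + b | a b. a \<in> A \<and> b \<in> B} \<and> f (Suc i) < f i"
  then obtain f :: "nat \<Rightarrow> rat" where f: "\<And>i. \<exists>a b. f i = a + b \<and> a \<in> A \<and> b \<in> B"
    and desc: "\<And>i. f (Suc i) < f i" by blast
  from f obtain a b where ab: "\<And>i. f i = a i + b i" "\<And>i. a i \<in> A" "\<And>i. b i \<in> B" by metis
  obtain g where g: "strict_mono g" "incseq (a \<circ> g)"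
    using well_ordered_monoseq_incseq[of A a, OF A ab(2)] by blast
  have less: "f (g (Suc i)) < f (g i)" for i
    by (rule descent_less[of f, OF desc]) (use g(1) in \<open>simp add: strict_mono_Suc_iff\<close>)
  have le: "a (g i) \<le> a (g (Suc i))" for i
    using incseq_SucD[OF g(2), of i] by simp
  have "b (g (Suc i)) < b (g i)" for i
    using less[of i] le[of i] ab(1)[of "g i"] ab(1)[of "g (Suc i)"] by linarith
  then show False
    using well_ordered_no_descent[OF B, of "\<lambda>i. b (g i)"] ab(3) by blast
qed

lemma well_ordered_Un:
  assumes "well_ordered A" "well_ordered B"
  shows "well_ordered (A \<union> B)"
  unfolding well_ordered_iff_no_descent
proof
  assume "\<exists>f :: nat \<Rightarrow> rat. \<forall>i. f i \<in> A \<union> B \<and> f (Suc i) < f i"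
  then obtain f :: "nat \<Rightarrow> rat" where f: "\<And>i. f i \<in> A \<union> B" and desc: "\<And>i. f (Suc i) < f i"
    by blast
  have fin: "finite {i. f i \<in> C}" if "well_ordered C" for C
  proof (rule ccontr)
    assume inf: "infinite {i. f i \<in> C}"
    have "f (enumerate {i. f i \<in> C} (Suc n)) < f (enumerate {i. f i \<in> C} n)" for n
      by (rule descent_less[of f, OF desc enumerate_step[OF inf]])
    moreover have "f (enumerate {i. f i \<in> C} n) \<in> C" for n
      using enumerate_in_set[OF inf, of n] by simp
    ultimately show False
      using well_ordered_no_descent[OF that, of "\<lambda>n. f (enumerate {i. f i \<in> C} n)"] by blast
  qed
  have "(UNIV :: nat set) = {i. f i \<in> A} \<union> {i. f i \<in> B}" using f by auto
  then show False
    using fin[OF assms(1)] fin[OF assms(2)] infinite_UNIV_nat by (metis finite_UnI)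
qed

text \<open>Infinitely many decompositions of \<open>q\<close> would contain some with increasing first summands and
  hence decreasing second ones.\<close>

lemma finite_decompositions:
  assumes A: "well_ordered A" and B: "well_ordered B"
  shows "finite {a \<in> A. q - a \<in> B}"
proof (rule ccontr)
  assume "infinite {a \<in> A. q - a \<in> B}"
  then obtain a :: "nat \<Rightarrow> rat" where a: "inj a" "range a \<subseteq> {a \<in> A. q - a \<in> B}"
    using infinite_countable_subset by blast
  obtain g where g: "strict_mono g" "incseq (a \<circ> g)"
    using well_ordered_monoseq_incseq[of A a] A a(2) by blast
  have "a (g i) \<noteq> a (g (Suc i))" for i
    using a(1) g(1) by (metis injD lessI less_irrefl strict_mono_less)
  then have "q - a (g (Suc i)) < q - a (g i)" for i
    using g(2) by (metis comp_apply diff_strict_left_mono incseq_SucD order_le_imp_less_or_eq)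
  moreover have "q - a i \<in> B" for i using a(2) by blast
  ultimately show False
    using well_ordered_no_descent[OF B, of "\<lambda>i. q - a (g i)"] by blast
qed


section \<open>The ring of Hahn series over a commutative ring\<close>

text \<open>With coefficients in a type of class \<^class>\<open>comm_ring_1\<close> the Hahn series form such a type
  again, so that the calculation with powers of the series can use ordinary algebra.\<close>

typedef (overloaded) 'a hahn = "{f :: rat \<Rightarrow> 'a::zero. well_ordered {q. f q \<noteq> 0}}"
  morphisms hcoeff Abs_hahn
  by (rule exI[of _ "\<lambda>_. 0"]) (simp add: well_ordered_finite)

setup_lifting type_definition_hahn

abbreviation hsupp :: "'a::zero hahn \<Rightarrow> rat set" where
  "hsupp F \<equiv> {q. hcoeff F q \<noteq> 0}"

lemma hahn_eqI: "(\<And>q. hcoeff F q = hcoeff G q) \<Longrightarrow> F = G"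
  by (simp add: hcoeff_inject[symmetric] fun_eq_iff)

lemma well_ordered_hsupp: "well_ordered (hsupp F)"
  using hcoeff by blast

lemma finite_hsupp_decompositions: "finite {a \<in> hsupp F. q - a \<in> hsupp G}"
  by (intro finite_decompositions well_ordered_hsupp)

lift_definition hmonom :: "'a::zero \<Rightarrow> rat \<Rightarrow> 'a hahn" is "\<lambda>c a q. if q = a then c else 0"
  by (rule well_ordered_finite) simp

instantiation hahn :: (comm_ring_1) comm_ring_1
begin

lift_definition zero_hahn :: "'a hahn" is "\<lambda>_. 0"
  by (rule well_ordered_finite) simp

lift_definition one_hahn :: "'a hahn" is "\<lambda>q. if q = 0 then 1 else 0"
  by (rule well_ordered_finite) simp

lift_definition plus_hahn :: "'a hahn \<Rightarrow> 'a hahn \<Rightarrow> 'a hahn" is "\<lambda>f g q. f q + g q"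
  by (erule (1) well_ordered_subset[OF well_ordered_Un]) auto

lift_definition uminus_hahn :: "'a hahn \<Rightarrow> 'a hahn" is "\<lambda>f q. - f q"
  by simp

lift_definition minus_hahn :: "'a hahn \<Rightarrow> 'a hahn \<Rightarrow> 'a hahn" is "\<lambda>f g q. f q - g q"
  by (erule (1) well_ordered_subset[OF well_ordered_Un]) auto

lift_definition times_hahn :: "'a hahn \<Rightarrow> 'a hahn \<Rightarrow> 'a hahn"
  is "\<lambda>f g q. \<Sum>a\<in>{a \<in> {a. f a \<noteq> 0}. q - a \<in> {b. g b \<noteq> 0}}. f a * g (q - a)"
proof -
  fix f g :: "rat \<Rightarrow> 'a"
  assume f: "well_ordered {a. f a \<noteq> 0}" and g: "well_ordered {b. g b \<noteq> 0}"
  show "well_ordered {q. (\<Sum>a\<in>{a \<in> {a. f a \<noteq> 0}. q - a \<in> {b. g b \<noteq> 0}}. f a * g (q - a)) \<noteq> 0}"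
  proof (rule well_ordered_subset[OF well_ordered_sumset[OF f g]], rule subsetI)
    fix q
    assume "q \<in> {q. (\<Sum>a\<in>{a \<in> {a. f a \<noteq> 0}. q - a \<in> {b. g b \<noteq> 0}}. f a * g (q - a)) \<noteq> 0}"
    then obtain a where "a \<in> {a \<in> {a. f a \<noteq> 0}. q - a \<in> {b. g b \<noteq> 0}}"
      unfolding mem_Collect_eq[of q] by (rule sum.not_neutral_contains_not_neutral)
    then have "q = a + (q - a) \<and> a \<in> {a. f a \<noteq> 0} \<and> q - a \<in> {b. g b \<noteq> 0}" by simp
    then show "q \<in> {a + b | a b. a \<in> {a. f a \<noteq> 0} \<and> b \<in> {b. g b \<noteq> 0}}" by blast
  qed
qed

lemma hcoeff_mult:
  fixes F G :: "'a hahn"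
  assumes "finite S" "\<And>a. hcoeff F a \<noteq> 0 \<Longrightarrow> hcoeff G (q - a) \<noteq> 0 \<Longrightarrow> a \<in> S"
  shows "hcoeff (F * G) q = (\<Sum>a\<in>S. hcoeff F a * hcoeff G (q - a))"
  unfolding times_hahn.rep_eq
  by (rule sum.mono_neutral_left) (use assms in auto)

lemma hcoeff_mult_nonzero:
  fixes F G :: "'a hahn"
  assumes "hcoeff (F * G) q \<noteq> 0"
  obtains a where "hcoeff F a \<noteq> 0" "hcoeff G (q - a) \<noteq> 0"
proof -
  have "(\<Sum>a\<in>{a \<in> hsupp F. q - a \<in> hsupp G}. hcoeff F a * hcoeff G (q - a)) \<noteq> 0"
    using assms unfolding times_hahn.rep_eq .
  then obtain a where "a \<in> {a \<in> hsupp F. q - a \<in> hsupp G}"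
    by (rule sum.not_neutral_contains_not_neutral)
  then show thesis using that by blast
qed

text \<open>Both sides sum over the decompositions $q = a + b + c$ with indices in the three supports; the
  two orders of summation group them by $a + b$ and by $a$.\<close>

lemma hahn_mult_assoc:
  fixes F G H :: "'a hahn"
  shows "F * G * H = F * (G * H)"
proof (rule hahn_eqI)
  fix q
  let ?FG = "{a + b | a b. a \<in> hsupp F \<and> b \<in> hsupp G}"
  let ?GH = "{a + b | a b. a \<in> hsupp G \<and> b \<in> hsupp H}"
  define S where "S = {s \<in> ?FG. q - s \<in> hsupp H}"
  define T where "T = {a \<in> hsupp F. q - a \<in> ?GH}"
  have fin: "finite S" "finite T" unfolding S_def T_def
    by (intro finite_decompositions well_ordered_sumset well_ordered_hsupp)+
  have "hcoeff (F * G * H) q = (\<Sum>s\<in>S. hcoeff (F * G) s * hcoeff H (q - s))"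
  proof (rule hcoeff_mult[OF fin(1)])
    fix s assume s: "hcoeff (F * G) s \<noteq> 0" "hcoeff H (q - s) \<noteq> 0"
    from s(1) obtain a where "hcoeff F a \<noteq> 0" "hcoeff G (s - a) \<noteq> 0" by (rule hcoeff_mult_nonzero)
    then have "s = a + (s - a) \<and> a \<in> hsupp F \<and> s - a \<in> hsupp G" by simp
    then have "s \<in> ?FG" by blast
    with s(2) show "s \<in> S" unfolding S_def by blast
  qed
  also have "\<dots> = (\<Sum>s\<in>S. \<Sum>a\<in>{a \<in> hsupp F. s - a \<in> hsupp G}.
      hcoeff F a * hcoeff G (s - a) * hcoeff H (q - s))"
    by (simp only: times_hahn.rep_eq sum_distrib_right)
  also have "\<dots> = (\<Sum>(s, a)\<in>Sigma S (\<lambda>s. {a \<in> hsupp F. s - a \<in> hsupp G}).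
      hcoeff F a * hcoeff G (s - a) * hcoeff H (q - s))"
    by (rule sum.Sigma) (use fin finite_hsupp_decompositions in blast)+
  also have "Sigma S (\<lambda>s. {a \<in> hsupp F. s - a \<in> hsupp G})
      = {(s, a). hcoeff F a \<noteq> 0 \<and> hcoeff G (s - a) \<noteq> 0 \<and> hcoeff H (q - s) \<noteq> 0}"
  proof -
    have "s \<in> ?FG" if "a \<in> hsupp F" "s - a \<in> hsupp G" for s a
    proof -
      have "s = a + (s - a)" by simp
      then show ?thesis using that by blast
    qed
    then show ?thesis unfolding S_def by blast
  qed
  also have "(\<Sum>(s, a)\<in>\<dots>. hcoeff F a * hcoeff G (s - a) * hcoeff H (q - s))
      = (\<Sum>(a, b)\<in>{(a, b). hcoeff F a \<noteq> 0 \<and> hcoeff G b \<noteq> 0 \<and> hcoeff H (q - a - b) \<noteq> 0}.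
      hcoeff F a * hcoeff G b * hcoeff H (q - a - b))"
    by (rule sum.reindex_bij_witness[of _ "\<lambda>(a, b). (a + b, a)" "\<lambda>(s, a). (a, s - a)"])
      (auto simp: diff_diff_eq)
  also have "{(a, b). hcoeff F a \<noteq> 0 \<and> hcoeff G b \<noteq> 0 \<and> hcoeff H (q - a - b) \<noteq> 0}
      = Sigma T (\<lambda>a. {b \<in> hsupp G. q - a - b \<in> hsupp H})"
  proof -
    have "q - a \<in> ?GH" if "b \<in> hsupp G" "q - a - b \<in> hsupp H" for a b
    proof -
      have "q - a = b + (q - a - b)" by simp
      then show ?thesis using that by blast
    qed
    then show ?thesis unfolding T_def by blast
  qed
  also have "(\<Sum>(a, b)\<in>\<dots>. hcoeff F a * hcoeff G b * hcoeff H (q - a - b))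
      = (\<Sum>a\<in>T. \<Sum>b\<in>{b \<in> hsupp G. q - a - b \<in> hsupp H}.
      hcoeff F a * hcoeff G b * hcoeff H (q - a - b))"
    by (rule sum.Sigma[symmetric]) (use fin finite_hsupp_decompositions in blast)+
  also have "\<dots> = (\<Sum>a\<in>T. hcoeff F a * hcoeff (G * H) (q - a))"
    by (simp only: times_hahn.rep_eq sum_distrib_left mult.assoc)
  also have "\<dots> = hcoeff (F * (G * H)) q"
  proof (rule hcoeff_mult[OF fin(2), symmetric])
    fix a assume s: "hcoeff F a \<noteq> 0" "hcoeff (G * H) (q - a) \<noteq> 0"
    from s(2) obtain b where "hcoeff G b \<noteq> 0" "hcoeff H (q - a - b) \<noteq> 0" by (rule hcoeff_mult_nonzero)
    then have "q - a = b + (q - a - b) \<and> b \<in> hsupp G \<and> q - a - b \<in> hsupp H" by simp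
    then have "q - a \<in> ?GH" by blast
    with s(1) show "a \<in> T" unfolding T_def by blast
  qed
  finally show "hcoeff (F * G * H) q = hcoeff (F * (G * H)) q" .
qed

lemma hahn_mult_commute:
  fixes F G :: "'a hahn"
  shows "F * G = G * F"
proof (rule hahn_eqI)
  fix q
  show "hcoeff (F * G) q = hcoeff (G * F) q"
    unfolding times_hahn.rep_eq
    by (rule sum.reindex_bij_witness[of _ "\<lambda>a. q - a" "\<lambda>a. q - a"]) (auto simp: mult.commute)
qed

lemma hahn_distrib_right:
  fixes F G H :: "'a hahn"
  shows "(F + G) * H = F * H + G * H"
proof (rule hahn_eqI)
  fix q
  define S where "S = {a \<in> hsupp F. q - a \<in> hsupp H} \<union> {a \<in> hsupp G. q - a \<in> hsupp H}"
  have fin: "finite S" unfolding S_def by (intro finite_UnI finite_hsupp_decompositions)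
  have "hcoeff ((F + G) * H) q = (\<Sum>a\<in>S. hcoeff (F + G) a * hcoeff H (q - a))"
    by (rule hcoeff_mult[OF fin]) (auto simp: S_def plus_hahn.rep_eq)
  also have "\<dots> = (\<Sum>a\<in>S. hcoeff F a * hcoeff H (q - a)) + (\<Sum>a\<in>S. hcoeff G a * hcoeff H (q - a))"
    by (simp add: plus_hahn.rep_eq distrib_right sum.distrib)
  also have "\<dots> = hcoeff (F * H) q + hcoeff (G * H) q"
    by (intro arg_cong2[where f = "(+)"] hcoeff_mult[symmetric] fin) (auto simp: S_def)
  finally show "hcoeff ((F + G) * H) q = hcoeff (F * H + G * H) q"
    by (simp add: plus_hahn.rep_eq)
qed

instance
proof
  fix F G H :: "'a hahn"
  show "F * G * H = F * (G * H)" by (rule hahn_mult_assoc)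
  show "F * G = G * F" by (rule hahn_mult_commute)
  show "(F + G) * H = F * H + G * H" by (rule hahn_distrib_right)
  show "1 * F = F"
  proof (rule hahn_eqI)
    fix q
    show "hcoeff (1 * F) q = hcoeff F q"
      by (subst hcoeff_mult[of "{0}"]) (auto simp: one_hahn.rep_eq split: if_splits)
  qed
  show "(0 :: 'a hahn) \<noteq> 1"
    by (metis one_hahn.rep_eq zero_hahn.rep_eq zero_neq_one)
qed (rule hahn_eqI; simp add: plus_hahn.rep_eq zero_hahn.rep_eq uminus_hahn.rep_eq minus_hahn.rep_eq algebra_simps)+

end

lemma hcoeff_simps [simp]:
  fixes F G :: "'a::comm_ring_1 hahn"
  shows "hcoeff 0 q = (0 :: 'a)" "hcoeff (F + G) q = hcoeff F q + hcoeff G q"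
    "hcoeff (- F) q = - hcoeff F q" "hcoeff (F - G) q = hcoeff F q - hcoeff G q"
    "hcoeff 1 q = (if q = 0 then 1 else (0 :: 'a))"
    "hcoeff (hmonom c a) q = (if q = a then c else (0 :: 'a))"
  by (simp_all add: plus_hahn.rep_eq zero_hahn.rep_eq uminus_hahn.rep_eq minus_hahn.rep_eq
      one_hahn.rep_eq hmonom.rep_eq)

lemma hcoeff_sum: "hcoeff (sum f A) q = (\<Sum>a\<in>A. hcoeff (f a) q)"
  by (induction A rule: infinite_finite_induct) simp_all

lemma ex_hahn_lower_bound: "\<exists>b. \<forall>x<b. hcoeff F x = 0"
  using well_ordered_bounded_below[OF well_ordered_hsupp[of F]] by (auto simp: not_less[symmetric])


section \<open>The ideal of Hahn series that vanish at $t = p$\<close>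

text \<open>On the class \<open>q + \<int>\<close> the value of a series at $t = p$ is $p^k$ times
  $\sum_{j \ge 0} p^j F(q + k + j)$ for any \<open>k\<close> below which \<open>F\<close> vanishes on the class; \<open>psum\<close> is
  the partial sum. Since the terms from the \<open>m\<close>-th on are divisible by $p^m$, the infinite sum
  is zero exactly if every partial sum of \<open>m\<close> terms is divisible by $p^m$, and \<open>null_hahn\<close> is
  stated in this form, which involves no limits.\<close>

definition vanishes_below :: "'a::comm_ring_1 hahn \<Rightarrow> rat \<Rightarrow> int \<Rightarrow> bool" where
  "vanishes_below F q k \<longleftrightarrow> (\<forall>n<k. hcoeff F (q + of_int n) = 0)"

definition psum :: "nat \<Rightarrow> 'a::comm_ring_1 hahn \<Rightarrow> rat \<Rightarrow> int \<Rightarrow> nat \<Rightarrow> 'a" where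
  "psum p F q k m = (\<Sum>j<m. of_nat p ^ j * hcoeff F (q + of_int (k + int j)))"

definition null_hahn :: "nat \<Rightarrow> 'a::comm_ring_1 hahn set" where
  "null_hahn p = {F. \<forall>q. \<exists>k. vanishes_below F q k \<and> (\<forall>m. of_nat p ^ m dvd psum p F q k m)}"

lemma psum_add: "psum p (F + G) q k m = psum p F q k m + psum p G q k m"
  by (simp add: psum_def distrib_left sum.distrib)

lemma psum_split:
  "psum p F q k (l + m) = psum p F q k l + of_nat p ^ l * psum p F q (k + int l) m"
proof (induction m)
  case (Suc m)
  have "psum p F q k (l + Suc m)
      = psum p F q k (l + m) + of_nat p ^ (l + m) * hcoeff F (q + of_int (k + int (l + m)))"
    by (simp add: psum_def)
  also have "\<dots> = psum p F q k l + of_nat p ^ l * psum p F q (k + int l) (Suc m)"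
    unfolding Suc by (simp add: psum_def power_add algebra_simps)
  finally show ?case .
qed (simp add: psum_def)

lemma psum_below: "vanishes_below F q (k + int l) \<Longrightarrow> psum p F q k l = 0"
  by (simp add: psum_def vanishes_below_def del: of_int_add)

lemma ex_vanishes_below: "\<exists>k0. \<forall>k\<le>k0. vanishes_below F q k"
proof -
  obtain b where b: "\<And>x. x < b \<Longrightarrow> hcoeff F x = 0" using ex_hahn_lower_bound by blast
  have "q + of_int n < b" if "n < k" "k \<le> \<lfloor>b - q\<rfloor>" for n k
    using that by linarith
  then show ?thesis unfolding vanishes_below_def using b by blast
qed

text \<open>The only properties of the coefficients, besides being a commutative ring, on which the
  independence argument rests.\<close>

locale prime_torsion_free =
  fixes p :: nat and ty :: "'a::comm_ring_1 itself"
  assumes prime: "prime p" and torsion_free: "of_nat p * (x :: 'a) = 0 \<Longrightarrow> x = 0"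
begin

lemma p_ge_2: "p \<ge> 2"
  using prime prime_ge_2_nat by blast

lemma p_power_cancel: "of_nat p ^ l * (x :: 'a) = of_nat p ^ l * y \<Longrightarrow> x = y"
proof (induction l)
  case (Suc l)
  from Suc.prems have "of_nat p * (of_nat p ^ l * x - of_nat p ^ l * y) = 0"
    by (simp add: algebra_simps)
  from torsion_free[OF this] show ?case by (intro Suc.IH) simp
qed simp

lemma p_power_dvd_cancel: "of_nat p ^ (l + m) dvd of_nat p ^ l * (x :: 'a) \<Longrightarrow> of_nat p ^ m dvd x"
  unfolding dvd_def by (metis p_power_cancel mult.assoc power_add)

text \<open>Moving the start by \<open>l\<close> multiplies the sum by $p^l$, which can be cancelled.\<close>

lemma psum_dvd_independent_of_start:
  fixes F :: "'a hahn"
  assumes k: "vanishes_below F q k" "\<And>m. of_nat p ^ m dvd psum p F q k m"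
    and k': "vanishes_below F q k'"
  shows "of_nat p ^ m dvd psum p F q k' m"
proof (cases "k \<le> k'")
  case True
  define l where "l = nat (k' - k)"
  have l: "k' = k + int l" using True by (simp add: l_def)
  have "psum p F q k (l + m) = of_nat p ^ l * psum p F q k' m"
    by (simp only: psum_split psum_below[OF k'[unfolded l]] l[symmetric] add_0)
  then have "of_nat p ^ (l + m) dvd of_nat p ^ l * psum p F q k' m"
    using k(2)[of "l + m"] by simp
  then show ?thesis by (rule p_power_dvd_cancel)
next
  case False
  define l where "l = nat (k - k')"
  have l: "k = k' + int l" using False by (simp add: l_def)
  have zero: "psum p F q k' i = 0" if "i \<le> l" for i
    using k(1) that by (intro psum_below) (auto simp: l vanishes_below_def)
  show ?thesis
  proof (cases "m \<le> l")
    case True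
    then show ?thesis by (simp add: zero)
  next
    case False
    then have m: "m = l + (m - l)" by simp
    have "psum p F q k' m = of_nat p ^ l * psum p F q k (m - l)"
      by (subst m) (simp only: psum_split zero[OF order_refl] l[symmetric] add_0)
    moreover have "(of_nat p ^ m :: 'a) = of_nat p ^ l * of_nat p ^ (m - l)"
      using m by (metis power_add)
    ultimately show ?thesis using k(2)[of "m - l"] by (simp add: mult_dvd_mono)
  qed
qed

lemma null_hahnD:
  fixes F :: "'a hahn"
  assumes "F \<in> null_hahn p" "vanishes_below F q k"
  shows "of_nat p ^ m dvd psum p F q k m"
proof -
  obtain k' where "vanishes_below F q k'" "\<And>m. of_nat p ^ m dvd psum p F q k' m"
    using assms(1) unfolding null_hahn_def by blast
  then show ?thesis using psum_dvd_independent_of_start assms(2) by blast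
qed

lemma null_hahn_zero: "(0 :: 'a hahn) \<in> null_hahn p"
  by (auto simp: null_hahn_def vanishes_below_def psum_def)

lemma null_hahn_add:
  fixes F G :: "'a hahn"
  assumes "F \<in> null_hahn p" "G \<in> null_hahn p"
  shows "F + G \<in> null_hahn p"
  unfolding null_hahn_def mem_Collect_eq
proof
  fix q
  obtain kF kG where k: "\<And>k. k \<le> kF \<Longrightarrow> vanishes_below F q k" "\<And>k. k \<le> kG \<Longrightarrow> vanishes_below G q k"
    using ex_vanishes_below by metis
  have F: "vanishes_below F q (min kF kG)" and G: "vanishes_below G q (min kF kG)"
    by (simp_all add: k)
  then have "vanishes_below (F + G) q (min kF kG)"
    by (simp add: vanishes_below_def)
  moreover have "of_nat p ^ m dvd psum p (F + G) q (min kF kG) m" for m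
    unfolding psum_add by (intro dvd_add null_hahnD assms F G)
  ultimately show "\<exists>k. vanishes_below (F + G) q k \<and> (\<forall>m. of_nat p ^ m dvd psum p (F + G) q k m)"
    by blast
qed

text \<open>Formally $\sum_n p^n (GF)(q+n) = \sum_a G(a) \sum_n p^n F(q-a+n) = 0$. One start \<open>k\<close> must serve
  all \<open>a\<close> in the support of \<open>G\<close> at once; the lower bounds of the two supports provide it. Only
  finitely many \<open>a\<close> matter for a given partial sum.\<close>

lemma null_hahn_mult:
  fixes F G :: "'a hahn"
  assumes F: "F \<in> null_hahn p"
  shows "G * F \<in> null_hahn p"
  unfolding null_hahn_def mem_Collect_eq
proof
  fix q
  obtain bF bG where b: "\<And>x. x < bF \<Longrightarrow> hcoeff F x = 0" "\<And>x. x < bG \<Longrightarrow> hcoeff G x = 0"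
    using ex_hahn_lower_bound by metis
  \<comment> \<open>Below \<open>bF + bG\<close> no exponent is a sum of exponents of \<open>F\<close> and \<open>G\<close>.\<close>
  define k where "k = \<lfloor>bF + bG - q\<rfloor>"
  have F_below: "vanishes_below F (q - a) k" if "hcoeff G a \<noteq> 0" for a
    unfolding vanishes_below_def
  proof (intro allI impI b(1))
    fix n assume "n < k"
    then have "of_int n < bF + bG - q" unfolding k_def by linarith
    moreover have "bG \<le> a" using b(2) that by (meson not_le)
    ultimately show "q - a + of_int n < bF" by linarith
  qed
  have "vanishes_below (G * F) q k"
    unfolding vanishes_below_def
  proof (intro allI impI, rule ccontr)
    fix n assume n: "n < k" and "hcoeff (G * F) (q + of_int n) \<noteq> 0"
    then obtain a where a: "hcoeff G a \<noteq> 0" "hcoeff F (q + of_int n - a) \<noteq> 0"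
      using hcoeff_mult_nonzero by blast
    have "q + of_int n - a = q - a + of_int n" by simp
    then show False using F_below[OF a(1)] a(2) n unfolding vanishes_below_def by metis
  qed
  moreover have "of_nat p ^ m dvd psum p (G * F) q k m" for m
  proof -
    define S where "S = (\<Union>j<m. {a \<in> hsupp G. q + of_int (k + int j) - a \<in> hsupp F})"
    have fin: "finite S" unfolding S_def by (intro finite_UN_I finite_hsupp_decompositions) simp
    have "psum p (G * F) q k m = (\<Sum>j<m. of_nat p ^ j *
        (\<Sum>a\<in>S. hcoeff G a * hcoeff F (q + of_int (k + int j) - a)))"
      unfolding psum_def
      by (intro sum.cong refl arg_cong2[where f = "(*)"] hcoeff_mult fin) (auto simp: S_def)
    also have "\<dots> = (\<Sum>a\<in>S. hcoeff G a * psum p F (q - a) k m)"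
      unfolding psum_def sum_distrib_left
      by (subst sum.swap) (simp add: algebra_simps)
    also have "of_nat p ^ m dvd \<dots>"
      using F_below by (intro dvd_sum dvd_mult null_hahnD F) (auto simp: S_def)
    finally show ?thesis .
  qed
  ultimately show "\<exists>k. vanishes_below (G * F) q k \<and> (\<forall>m. of_nat p ^ m dvd psum p (G * F) q k m)"
    by blast
qed

lemma null_hahn_diff:
  fixes F G :: "'a hahn"
  assumes "F \<in> null_hahn p" "G \<in> null_hahn p"
  shows "F - G \<in> null_hahn p"
  using null_hahn_add[OF assms(1) null_hahn_mult[OF assms(2), of "-1"]] by simp

text \<open>For $N = p^l u$ with \<open>u\<close> prime to \<open>p\<close>, the divisibility at \<open>l + m\<close> loses the factor $p^l$
  by cancellation and the factor \<open>u\<close> because \<open>u\<close> is invertible modulo $p^m$; the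
  Cauchy condition leads back from \<open>l + m\<close> to \<open>m\<close>. It removes the factor $d!$ below.\<close>

lemma dvd_of_dvd_multiple:
  fixes s :: "nat \<Rightarrow> 'a"
  assumes N: "N > 0" and dvd: "\<And>m. of_nat p ^ m dvd of_nat N * s m"
    and cauchy: "\<And>l m. of_nat p ^ m dvd s (l + m) - s m"
  shows "of_nat p ^ m dvd s m"
proof -
  obtain l u where Nlu: "N = p ^ l * u" and u: "\<not> p dvd u"
    using multiplicity_decompose'[of N p] N prime by (metis not_prime_unit less_irrefl)
  have "coprime (int u) (int p ^ m)"
    using u prime prime_imp_coprime_nat by (metis coprime_commute coprime_int_iff coprime_power_right_iff of_nat_power)
  then obtain x y where "int u * x + int p ^ m * y = 1"
    using bezout_int[of "int u" "int p ^ m"] by (metis coprime_imp_gcd_eq_1 mult.commute)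
  then have bez: "of_nat u * of_int x + of_nat p ^ m * of_int y = (1 :: 'a)"
    by (metis of_int_1 of_int_add of_int_mult of_int_of_nat_eq of_int_power)
  have "of_nat p ^ (l + m) dvd of_nat p ^ l * (of_nat u * s (l + m))"
    using dvd[of "l + m"] by (simp add: Nlu mult.assoc)
  then have u_dvd: "of_nat p ^ m dvd of_nat u * s (l + m)"
    by (rule p_power_dvd_cancel)
  have "s (l + m) = (of_nat u * of_int x + of_nat p ^ m * of_int y) * s (l + m)"
    by (simp only: bez mult_1)
  also have "\<dots> = of_int x * (of_nat u * s (l + m)) + of_nat p ^ m * (of_int y * s (l + m))"
    by (simp add: algebra_simps)
  finally have "of_nat p ^ m dvd s (l + m)"
    using dvd_add[OF dvd_mult[OF u_dvd] dvd_triv_left] by metis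
  from dvd_diff[OF this cauchy] have "of_nat p ^ m dvd s (l + m) - (s (l + m) - s m)" .
  then show ?thesis by simp
qed

end


section \<open>Sums of negative powers of $p$ modulo the integers\<close>

definition frac_sum :: "nat \<Rightarrow> nat multiset \<Rightarrow> rat" where
  "frac_sum p M = (\<Sum>k\<in>#M. 1 / of_nat p ^ k)"

lemma frac_sum_simps [simp]:
  "frac_sum p {#} = 0" "frac_sum p (add_mset k M) = 1 / of_nat p ^ k + frac_sum p M"
  "frac_sum p (M + M') = frac_sum p M + frac_sum p M'"
  "frac_sum p (replicate_mset c k) = of_nat c / of_nat p ^ k"
proof -
  show "frac_sum p (replicate_mset c k) = of_nat c / of_nat p ^ k"
    by (induction c) (simp_all add: frac_sum_def add_divide_distrib)
qed (simp_all add: frac_sum_def)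

lemma frac_sum_Ints:
  assumes "p > 0" "\<forall>k\<in>#M. k \<le> N"
  shows "of_nat p ^ N * frac_sum p M \<in> \<int>"
  using assms(2)
proof (induction M)
  case (add k M)
  have "of_nat p ^ N * (1 / of_nat p ^ k) = (of_nat p ^ (N - k) :: rat)"
    using add.prems assms(1) by (simp add: power_diff)
  moreover have "of_nat p ^ N * frac_sum p M \<in> \<int>" using add by simp
  ultimately show ?case by (simp only: frac_sum_simps distrib_left) simp
qed simp

text \<open>Among the representations of an element of \<open>\<rat>/\<int>\<close> as a sum of negative powers of \<open>p\<close>, one
  with at most one copy of each power is the base-\<open>p\<close> expansion, and it is the
  unique shortest one: any other can be shortened by carrying, that is, by trading \<open>p\<close> copies of
  $p^{-(N+1)}$ for one copy of $p^{-N}$. The induction is on a bound for the exponents: the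
  copies of the smallest power beyond those in \<open>J\<close> are a multiple of \<open>p\<close> in number and are
  all carried. A carry across the point produces integers, that is, copies of $p^0$, which is why
  \<open>M\<close> may contain 0 while \<open>J\<close> may not.\<close>

lemma frac_sum_minimal:
  assumes p: "p \<ge> 2"
    and J: "finite J" "0 \<notin> J" and M: "\<forall>k\<in>#M. k \<le> N" "\<forall>k\<in>J. k \<le> N"
    and int: "frac_sum p M - frac_sum p (mset_set J) \<in> \<int>"
  shows "card J \<le> size M \<and> (size M = card J \<longrightarrow> M = mset_set J)"
  using J M int
proof (induction N arbitrary: M J)
  case 0
  then have "J = {}" by fastforce
  then show ?case by auto
next
  case (Suc N)
  define c where "c = count M (Suc N)"
  define M0 where "M0 = filter_mset (\<lambda>k. k \<noteq> Suc N) M"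
  define J0 where "J0 = J - {Suc N}"
  define e :: nat where "e = (if Suc N \<in> J then 1 else 0)"
  have M_eq: "M = M0 + replicate_mset c (Suc N)"
    by (rule multiset_eqI) (auto simp: M0_def c_def)
  have fin0: "finite J0" using Suc.prems by (simp add: J0_def)
  have J_eq: "mset_set J = mset_set J0 + replicate_mset e (Suc N)"
    using mset_set.remove[OF Suc.prems(1), of "Suc N"] by (cases "Suc N \<in> J") (simp_all add: J0_def e_def)
  have card_J: "card J = card J0 + e"
    using card.remove[OF Suc.prems(1), of "Suc N"] by (cases "Suc N \<in> J") (simp_all add: J0_def e_def)
  have M0: "\<forall>k\<in>#M0. k \<le> N" and J0: "\<forall>k\<in>J0. k \<le> N"
    using Suc.prems(3,4) by (auto simp: M0_def J0_def le_Suc_eq)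
  have p0: "(of_nat p :: rat) \<noteq> 0" using p by simp
  let ?r = "frac_sum p M0 - frac_sum p (mset_set J0)"
  have r_int: "of_nat p ^ N * ?r \<in> \<int>"
    using frac_sum_Ints[of p M0 N] frac_sum_Ints[of p "mset_set J0" N] M0 J0 fin0 p
    by (simp add: right_diff_distrib)
  have total: "frac_sum p M - frac_sum p (mset_set J) = ?r + (of_nat c - of_nat e) / of_nat p ^ Suc N"
    by (simp add: M_eq J_eq diff_divide_distrib)
  \<comment> \<open>All other powers have exponents at most \<open>N\<close>, so after scaling by $p^N$ the surplus
    \<open>c - e\<close> of the smallest power must be divisible by \<open>p\<close>.\<close>
  obtain d where d: "int c - int e = int p * d"
  proof -
    have scaled: "of_nat p ^ N * (?r + (of_nat c - of_nat e) / of_nat p ^ Suc N)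
        = of_nat p ^ N * ?r + (of_nat c - of_nat e) / of_nat p"
      using p0 by (simp add: distrib_left)
    have "of_nat p ^ N * (?r + (of_nat c - of_nat e) / of_nat p ^ Suc N) \<in> \<int>"
      using Suc.prems(5) unfolding total by (intro Ints_mult Ints_power) simp_all
    from Ints_diff[OF this r_int] have "(of_nat c - of_nat e) / of_nat p \<in> (\<int> :: rat set)"
      unfolding scaled by simp
    then obtain d where "(of_nat c - of_nat e) / of_nat p = (of_int d :: rat)" by (rule Ints_cases)
    then have "of_int (int c - int e) = (of_int (int p * d) :: rat)"
      using p0 by (simp add: field_simps)
    then show thesis using that of_int_eq_iff by blast
  qed
  have "d \<ge> 0"
  proof (rule ccontr)
    assume "\<not> d \<ge> 0"
    then have "int p * d \<le> int p * (-1)" by (intro mult_left_mono) auto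
    then show False using d p by (auto simp: e_def split: if_splits)
  qed
  then obtain d' where d': "d = int d'" using nonneg_int_cases by blast
  have c: "c = e + p * d'"
  proof -
    have "int c = int (e + p * d')" using d unfolding d' by simp
    then show ?thesis by (simp only: of_nat_eq_iff)
  qed
  \<comment> \<open>The surplus is carried: $p d'$ copies of the smallest power become $d'$ copies of the next one.\<close>
  let ?M = "M0 + replicate_mset d' N"
  have carry: "(of_nat c - of_nat e) / of_nat p ^ Suc N = (of_nat d' / of_nat p ^ N :: rat)"
    unfolding c using p0 by simp
  have "frac_sum p ?M - frac_sum p (mset_set J0) = frac_sum p M - frac_sum p (mset_set J)"
    unfolding total carry by simp
  then have IH: "card J0 \<le> size ?M \<and> (size ?M = card J0 \<longrightarrow> ?M = mset_set J0)"
    using Suc.prems M0 J0 fin0 by (intro Suc.IH) (auto simp: J0_def)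
  have size_M: "size M = size M0 + e + p * d'" by (simp add: M_eq c)
  have IH_le: "card J0 \<le> size M0 + d'" using IH by simp
  have pd: "2 * d' \<le> p * d'" using p by simp
  show ?case
  proof (intro conjI impI)
    show "card J \<le> size M" using IH_le pd unfolding size_M card_J by linarith
  next
    assume "size M = card J"
    then have "d' = 0" using IH_le pd unfolding size_M card_J by linarith
    moreover from this have "size ?M = card J0"
      using \<open>size M = card J\<close> unfolding size_M card_J by simp
    ultimately show "M = mset_set J" using IH by (simp add: M_eq J_eq c)
  qed
qed

lemma frac_sum_congruent:
  assumes "p \<ge> 2" "finite J" "0 \<notin> J" "frac_sum p M - frac_sum p (mset_set J) \<in> \<int>" "size M \<le> card J"
  shows "M = mset_set J"
proof -
  have "\<forall>k\<in>#M. k \<le> Max (insert 0 (set_mset M \<union> J))" "\<forall>k\<in>J. k \<le> Max (insert 0 (set_mset M \<union> J))"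
    using assms(2) by auto
  from frac_sum_minimal[OF assms(1,2,3) this assms(4)] show ?thesis using assms(5) by simp
qed


section \<open>Independence of the powers of $\sum_k t^{-1/p^k}$\<close>

lemma well_ordered_neg_inverse_powers:
  assumes p: "p \<ge> 2"
  shows "well_ordered {q. \<exists>k\<ge>1. q = - (1 / of_nat p ^ k)}"
proof (rule well_ordered_iff_no_descent[THEN iffD2], safe)
  fix f :: "nat \<Rightarrow> rat"
  assume f: "\<forall>i. f i \<in> {q. \<exists>k\<ge>1. q = - (1 / of_nat p ^ k)} \<and> f (Suc i) < f i"
  then have "\<forall>i. \<exists>k. f i = - (1 / of_nat p ^ k)" by blast
  then obtain k where k: "\<And>i. f i = - (1 / of_nat p ^ k i)" by metis
  have "k (Suc i) < k i" for i
  proof (rule ccontr)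
    assume "\<not> k (Suc i) < k i"
    then have "(of_nat p :: rat) ^ k i \<le> of_nat p ^ k (Suc i)"
      using p by (intro power_increasing) auto
    moreover have "f (Suc i) < f i" using f by blast
    ultimately show False using p by (simp add: k field_simps)
  qed
  then show False
    using wf_less_than unfolding wf_iff_no_infinite_down_chain by auto
qed

text \<open>The series $\sum_{k \ge 1} t^{-1/p^k}$. The values for $p < 2$ are a default.\<close>

lift_definition neg_power_series :: "nat \<Rightarrow> 'a::comm_ring_1 hahn"
  is "\<lambda>p q. if p \<ge> 2 \<and> (\<exists>k\<ge>1. q = - (1 / of_nat p ^ k)) then 1 else 0"
proof -
  fix p :: nat
  show "well_ordered {q. (if p \<ge> 2 \<and> (\<exists>k\<ge>1. q = - (1 / of_nat p ^ k)) then 1 else 0 :: 'a) \<noteq> 0}"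
  proof (cases "p \<ge> 2")
    case True
    show ?thesis
      by (rule well_ordered_subset[OF well_ordered_neg_inverse_powers[OF True]]) auto
  qed (simp add: well_ordered_finite)
qed

lemma hcoeff_neg_power_series:
  "p \<ge> 2 \<Longrightarrow> hcoeff (neg_power_series p :: 'a::comm_ring_1 hahn) q
     = (if \<exists>k\<ge>1. q = - (1 / of_nat p ^ k) then 1 else 0)"
  by (simp add: neg_power_series.rep_eq)

lemma neg_power_series_power_support:
  assumes p: "p \<ge> 2" and "hcoeff ((neg_power_series p :: 'a::comm_ring_1 hahn) ^ i) x \<noteq> 0"
  shows "\<exists>M. size M = i \<and> x = - frac_sum p M"
  using assms(2)
proof (induction i arbitrary: x)
  case 0
  then show ?case by (auto split: if_splits)
next
  case (Suc i)
  from Suc.prems obtain a where a: "hcoeff (neg_power_series p :: 'a hahn) a \<noteq> 0"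
    "hcoeff ((neg_power_series p :: 'a hahn) ^ i) (x - a) \<noteq> 0"
    unfolding power_Suc by (rule hcoeff_mult_nonzero)
  from a(1) obtain k where k: "a = - (1 / of_nat p ^ k)"
    by (auto simp: hcoeff_neg_power_series[OF p] split: if_splits)
  from Suc.IH[OF a(2)] obtain M where "size M = i" "x - a = - frac_sum p M" by blast
  then have "size (add_mset k M) = Suc i \<and> x = - frac_sum p (add_mset k M)"
    by (simp add: k algebra_simps)
  then show ?case by blast
qed

text \<open>A factor $t^{-1/p^k}$ can only be split off with \<open>k \<in> J\<close>, since by \<open>frac_sum_congruent\<close> the
  remaining exponent would otherwise need too many summands. So the coefficient counts the
  orderings of \<open>J\<close>.\<close>

lemma neg_power_series_power_coeff_fact:
  assumes p: "p \<ge> 2" and "finite J" "0 \<notin> J" "card J = d"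
  shows "hcoeff ((neg_power_series p :: 'a::comm_ring_1 hahn) ^ d) (- frac_sum p (mset_set J)) = of_nat (fact d)"
  using assms(2-)
proof (induction d arbitrary: J)
  case 0
  then show ?case by simp
next
  case (Suc d)
  let ?A = "neg_power_series p :: 'a hahn"
  let ?a = "\<lambda>k. - (1 / of_nat p ^ k) :: rat"
  let ?x = "- frac_sum p (mset_set J)"
  have shift: "?x - ?a k = - frac_sum p (mset_set (J - {k}))" if "k \<in> J" for k
    using mset_set.remove[OF Suc.prems(1) that] by simp
  have inj: "inj_on ?a J"
    using p by (auto simp: inj_on_def power_inject_exp)
  have "hcoeff (?A * ?A ^ d) ?x = (\<Sum>a\<in>?a ` J. hcoeff ?A a * hcoeff (?A ^ d) (?x - a))"
  proof (rule hcoeff_mult)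
    show "finite (?a ` J)" using Suc.prems(1) by simp
    fix a assume a: "hcoeff ?A a \<noteq> 0" "hcoeff (?A ^ d) (?x - a) \<noteq> 0"
    from a(1) obtain k where k: "a = ?a k"
      by (auto simp: hcoeff_neg_power_series[OF p] split: if_splits)
    from neg_power_series_power_support[OF p a(2)] obtain M
      where M: "size M = d" "?x - a = - frac_sum p M" by blast
    \<comment> \<open>Together with the split-off power, \<open>M\<close> is a representation of minimal length.\<close>
    have "add_mset k M = mset_set J"
      using M Suc.prems by (intro frac_sum_congruent[OF p]) (simp_all add: k algebra_simps)
    then have "k \<in># mset_set J" by (metis union_single_eq_member)
    then show "a \<in> ?a ` J" using Suc.prems(1) k by simp
  qed
  also have "\<dots> = (\<Sum>k\<in>J. hcoeff ?A (?a k) * hcoeff (?A ^ d) (?x - ?a k))"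
    using inj by (simp only: sum.reindex comp_def)
  also have "\<dots> = (\<Sum>k\<in>J. of_nat (fact d))"
  proof (rule sum.cong)
    fix k assume k: "k \<in> J"
    then have "k \<ge> 1" using Suc.prems(2) by (cases k) auto
    then have "hcoeff ?A (?a k) = 1" by (auto simp: hcoeff_neg_power_series[OF p])
    moreover have "hcoeff (?A ^ d) (?x - ?a k) = of_nat (fact d)"
      unfolding shift[OF k] using Suc.prems k by (intro Suc.IH) auto
    ultimately show "hcoeff ?A (?a k) * hcoeff (?A ^ d) (?x - ?a k) = of_nat (fact d)" by simp
  qed simp
  also have "\<dots> = of_nat (fact (Suc d))"
    using Suc.prems(3) by (simp add: algebra_simps)
  finally show ?case by simp
qed

lemma neg_power_series_power_coeff_zero:
  assumes p: "p \<ge> 2" and J: "finite J" "0 \<notin> J" "i \<le> card J"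
    and nz: "hcoeff ((neg_power_series p :: 'a::comm_ring_1 hahn) ^ i) (- frac_sum p (mset_set J) + of_int n) \<noteq> 0"
  shows "i = card J \<and> n = 0"
proof -
  obtain M where M: "size M = i" "- frac_sum p (mset_set J) + of_int n = - frac_sum p M"
    using neg_power_series_power_support[OF p nz] by blast
  have "frac_sum p M - frac_sum p (mset_set J) = of_int (- n)" using M(2) by simp
  then have "frac_sum p M - frac_sum p (mset_set J) \<in> \<int>" using Ints_of_int by metis
  then have "M = mset_set J" using M(1) J by (intro frac_sum_congruent[OF p]) auto
  then show ?thesis using M J by simp
qed

text \<open>Elements of the field $W[1/p]$ have representatives of this kind, and so do their differences.\<close>

definition integral_support :: "'a::comm_ring_1 hahn \<Rightarrow> bool" where
  "integral_support F \<longleftrightarrow> (\<forall>x. hcoeff F x \<noteq> 0 \<longrightarrow> x \<in> \<int>)"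

lemma integral_support_mult_power_coeff:
  fixes h :: "'a::comm_ring_1 hahn"
  assumes p: "p \<ge> 2" and J: "finite J" "0 \<notin> J" "i \<le> card J" and h: "integral_support h"
  shows "hcoeff (h * neg_power_series p ^ i) (- frac_sum p (mset_set J) + of_int n)
    = (if i = card J then of_nat (fact i) * hcoeff h (of_int n) else 0)"
proof -
  let ?A = "neg_power_series p :: 'a hahn"
  let ?x = "- frac_sum p (mset_set J)"
  have "hcoeff (h * ?A ^ i) (?x + of_int n)
      = (\<Sum>a\<in>(if i = card J then {of_int n} else {}). hcoeff h a * hcoeff (?A ^ i) (?x + of_int n - a))"
  proof (rule hcoeff_mult)
    fix a assume a: "hcoeff h a \<noteq> 0" "hcoeff (?A ^ i) (?x + of_int n - a) \<noteq> 0"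
    from a(1) h obtain z where z: "a = of_int z" unfolding integral_support_def by (metis Ints_cases)
    have "?x + of_int n - a = ?x + of_int (n - z)" by (simp add: z)
    from neg_power_series_power_coeff_zero[OF p J a(2)[unfolded this]]
    show "a \<in> (if i = card J then {of_int n} else {})" by (simp add: z)
  qed simp
  then show ?thesis
    using neg_power_series_power_coeff_fact[OF p J(1,2) refl, where 'a = 'a]
    by (simp add: mult.commute)
qed

context prime_torsion_free
begin

text \<open>With $J = \{1, \dots, d\}$, where \<open>d\<close> is the highest exponent that occurs, the class modulo
  \<open>\<int>\<close> of $-\sum_{j \in J} p^{-j}$ is out of reach for the lower powers, and on it the whole sum is
  a shifted copy of \<open>d! h\<^sub>d\<close>. So \<open>h\<^sub>d\<close> vanishes at $t = p$, and its term can be subtracted.\<close>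

lemma null_if_power_sum_null:
  fixes h :: "nat \<Rightarrow> 'a hahn"
  assumes "(\<Sum>i<n. h i * neg_power_series p ^ i) \<in> null_hahn p"
    and "\<And>i. i < n \<Longrightarrow> integral_support (h i)" and "i < n"
  shows "h i \<in> null_hahn p"
  using assms
proof (induction n arbitrary: i)
  case (Suc d)
  let ?A = "neg_power_series p :: 'a hahn"
  let ?F = "\<Sum>i<Suc d. h i * ?A ^ i"
  define J where "J = {1..d}"
  define q where "q = - frac_sum p (mset_set J)"
  have J: "finite J" "0 \<notin> J" "card J = d" by (auto simp: J_def)
  have F_coeff: "hcoeff ?F (q + of_int n) = of_nat (fact d) * hcoeff (h d) (of_int n)" for n
  proof -
    have "hcoeff ?F (q + of_int n)
        = (\<Sum>i<Suc d. if i = d then of_nat (fact i) * hcoeff (h i) (of_int n) else 0)"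
      unfolding hcoeff_sum q_def
    proof (rule sum.cong)
      fix i assume "i \<in> {..<Suc d}"
      then show "hcoeff (h i * ?A ^ i) (- frac_sum p (mset_set J) + of_int n)
          = (if i = d then of_nat (fact i) * hcoeff (h i) (of_int n) else 0)"
        using integral_support_mult_power_coeff[OF p_ge_2 J(1,2), of i "h i" n] Suc.prems(2) J(3)
        by auto
    qed simp
    then show ?thesis by (simp add: sum.delta)
  qed
  obtain k where k: "vanishes_below (h d) 0 k" using ex_vanishes_below by blast
  then have Fk: "vanishes_below ?F q k" unfolding vanishes_below_def F_coeff by simp
  have "psum p ?F q k m = of_nat (fact d) * psum p (h d) 0 k m" for m
    unfolding psum_def F_coeff sum_distrib_left by (simp add: mult.left_commute)
  then have "of_nat p ^ m dvd of_nat (fact d) * psum p (h d) 0 k m" for m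
    using null_hahnD[OF Suc.prems(1) Fk, of m] by simp
  moreover have "of_nat p ^ m dvd psum p (h d) 0 k (l + m) - psum p (h d) 0 k m" for l m
    unfolding add.commute[of l m] psum_split by simp
  ultimately have dvd: "of_nat p ^ m dvd psum p (h d) 0 k m" for m
    by (rule dvd_of_dvd_multiple[OF fact_gt_zero])
  have null: "h d \<in> null_hahn p"
    unfolding null_hahn_def mem_Collect_eq
  proof
    fix x
    show "\<exists>k. vanishes_below (h d) x k \<and> (\<forall>m. of_nat p ^ m dvd psum p (h d) x k m)"
    proof (cases "x \<in> \<int>")
      case True
      then obtain z where z: "x = of_int z" by (rule Ints_cases)
      have "vanishes_below (h d) x (k - z)"
        unfolding vanishes_below_def
      proof (intro allI impI)
        fix n assume "n < k - z"
        then have "hcoeff (h d) (0 + of_int (z + n)) = 0"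
          using k unfolding vanishes_below_def by (smt (verit))
        then show "hcoeff (h d) (x + of_int n) = 0" by (simp add: z)
      qed
      moreover have "psum p (h d) x (k - z) m = psum p (h d) 0 k m" for m
        by (simp add: psum_def z)
      ultimately show ?thesis using dvd by metis
    next
      case False
      have "hcoeff (h d) (x + of_int n) = 0" for n
      proof (rule ccontr)
        assume "hcoeff (h d) (x + of_int n) \<noteq> 0"
        then have "x + of_int n \<in> \<int>" using Suc.prems(2)[of d] by (auto simp: integral_support_def)
        then have "x + of_int n - of_int n \<in> \<int>" by (rule Ints_diff) simp
        then show False using False by simp
      qed
      then show ?thesis by (simp add: vanishes_below_def psum_def del: of_int_add)
    qed
  qed
  have "?F - ?A ^ d * h d \<in> null_hahn p"
    by (intro null_hahn_diff null_hahn_mult null Suc.prems(1))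
  then have "(\<Sum>i<d. h i * ?A ^ i) \<in> null_hahn p" by (simp add: mult.commute)
  then show ?case using Suc.IH[of i] Suc.prems null by (cases "i = d") simp_all
qed simp

end


section \<open>Transfer to the quotient ring\<close>

text \<open>A ring record presented by a bijection from a type of class \<^class>\<open>comm_ring_1\<close>.\<close>

locale ring_coding = cring R for R :: "('r, 'm) ring_scheme" (structure) +
  fixes \<rho> :: "'a::comm_ring_1 \<Rightarrow> 'r"
  assumes inj: "inj \<rho>" and range: "range \<rho> = carrier R"
    and plus: "\<rho> (x + y) = \<rho> x \<oplus> \<rho> y" and times: "\<rho> (x * y) = \<rho> x \<otimes> \<rho> y"
    and one: "\<rho> 1 = \<one>"
begin

lemma closed [simp]: "\<rho> x \<in> carrier R"
  using range by blast

lemma eq_iff [simp]: "\<rho> x = \<rho> y \<longleftrightarrow> x = y"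
  using inj by (simp add: inj_eq)

lemma zero: "\<rho> 0 = \<zero>"
proof -
  have "\<rho> 0 \<oplus> \<rho> 0 = \<rho> 0" unfolding plus[symmetric] by simp
  then show ?thesis using add.l_cancel_one by simp
qed

lemma eq_zero_iff [simp]: "\<rho> x = \<zero> \<longleftrightarrow> x = 0"
  unfolding zero[symmetric] by simp

lemma of_nat_times: "\<rho> (of_nat n * x) = add_pow R n (\<rho> x)"
proof (induction n)
  case (Suc n)
  have "\<rho> (of_nat (Suc n) * x) = \<rho> (of_nat n * x) \<oplus> \<rho> x"
    by (simp add: plus[symmetric] distrib_right add.commute)
  then show ?case by (simp only: Suc add.nat_pow_Suc)
qed (simp add: zero)

lemma sum: "finite A \<Longrightarrow> \<rho> (sum f A) = (\<Oplus>a\<in>A. \<rho> (f a))"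
  by (induction A rule: finite_induct) (simp_all add: zero plus)

lemma dvd_iff: "of_nat n dvd x \<longleftrightarrow> (\<exists>y\<in>carrier R. \<rho> x = add_pow R n y)"
  unfolding range[symmetric] dvd_def by (simp add: of_nat_times[symmetric])

text \<open>Coefficientwise \<open>\<rho>\<close>: an isomorphism from the type of Hahn series to \<^const>\<open>hahn_ring\<close>.\<close>

definition \<Phi> :: "'a hahn \<Rightarrow> rat \<Rightarrow> 'r" where
  "\<Phi> F = (\<lambda>q. \<rho> (hcoeff F q))"

lemma \<Phi>_supp: "hahn_supp R (\<Phi> F) = hsupp F"
  by (simp add: hahn_supp_def \<Phi>_def)

lemma \<Phi>_carrier: "carrier (hahn_ring R) = range \<Phi>"
proof (intro equalityI subsetI)
  fix f assume "f \<in> carrier (hahn_ring R)"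
  then have f: "\<And>q. f q \<in> range \<rho>" and wo: "well_ordered (hahn_supp R f)"
    by (auto simp: hahn_ring_def range)
  define g where "g = (\<lambda>q. inv_into UNIV \<rho> (f q))"
  have fg: "f q = \<rho> (g q)" for q
    unfolding g_def using f_inv_into_f[OF f] by simp
  have "well_ordered {q. g q \<noteq> 0}"
    using wo by (simp add: hahn_supp_def fg)
  then have "hcoeff (Abs_hahn g) = g" by (simp add: Abs_hahn_inverse)
  then have "f = \<Phi> (Abs_hahn g)" by (simp add: \<Phi>_def fun_eq_iff fg)
  then show "f \<in> range \<Phi>" by blast
next
  fix f assume "f \<in> range \<Phi>"
  then obtain F where "f = \<Phi> F" by blast
  then show "f \<in> carrier (hahn_ring R)"
    using well_ordered_hsupp[of F] \<Phi>_supp[of F] by (auto simp: hahn_ring_def \<Phi>_def)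
qed

lemma \<Phi>_plus: "\<Phi> (F + G) = \<Phi> F \<oplus>\<^bsub>hahn_ring R\<^esub> \<Phi> G"
  by (simp add: \<Phi>_def hahn_ring_def plus)

lemma \<Phi>_zero: "\<Phi> 0 = \<zero>\<^bsub>hahn_ring R\<^esub>"
  by (simp add: \<Phi>_def hahn_ring_def zero)

lemma \<Phi>_one: "\<Phi> 1 = \<one>\<^bsub>hahn_ring R\<^esub>"
  by (auto simp: \<Phi>_def hahn_ring_def hahn_monom_def zero one fun_eq_iff)

lemma \<Phi>_times: "\<Phi> (F * G) = \<Phi> F \<otimes>\<^bsub>hahn_ring R\<^esub> \<Phi> G"
proof
  fix q
  have "\<Phi> (F * G) q = (\<Oplus>a\<in>{a \<in> hsupp F. q - a \<in> hsupp G}. \<rho> (hcoeff F a * hcoeff G (q - a)))"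
    unfolding \<Phi>_def times_hahn.rep_eq by (rule sum[OF finite_hsupp_decompositions])
  also have "\<dots> = (\<Phi> F \<otimes>\<^bsub>hahn_ring R\<^esub> \<Phi> G) q"
    unfolding \<Phi>_supp[symmetric] by (simp add: hahn_ring_def times \<Phi>_def)
  finally show "\<Phi> (F * G) q = (\<Phi> F \<otimes>\<^bsub>hahn_ring R\<^esub> \<Phi> G) q" .
qed

lemma cring_hahn_ring: "cring (hahn_ring R)"
proof (rule cringI)
  show "abelian_group (hahn_ring R)"
  proof (rule abelian_groupI)
    fix f assume "f \<in> carrier (hahn_ring R)"
    then obtain F where "f = \<Phi> F" by (auto simp: \<Phi>_carrier)
    moreover have "\<Phi> (- F) \<oplus>\<^bsub>hahn_ring R\<^esub> \<Phi> F = \<zero>\<^bsub>hahn_ring R\<^esub>"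
      by (simp add: \<Phi>_plus[symmetric] \<Phi>_zero)
    ultimately show "\<exists>g\<in>carrier (hahn_ring R). g \<oplus>\<^bsub>hahn_ring R\<^esub> f = \<zero>\<^bsub>hahn_ring R\<^esub>"
      unfolding \<Phi>_carrier by blast
  qed (auto simp: \<Phi>_carrier \<Phi>_plus[symmetric] \<Phi>_zero[symmetric] ac_simps)
  show "comm_monoid (hahn_ring R)"
    by (rule comm_monoidI)
      (auto simp: \<Phi>_carrier \<Phi>_times[symmetric] \<Phi>_one[symmetric] ac_simps)
qed (auto simp: \<Phi>_carrier \<Phi>_times[symmetric] \<Phi>_plus[symmetric] distrib_right)

lemma \<Phi>_minus: "\<Phi> (F - G) = \<Phi> F \<ominus>\<^bsub>hahn_ring R\<^esub> \<Phi> G"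
proof -
  interpret H: cring "hahn_ring R" by (rule cring_hahn_ring)
  have "\<Phi> F = \<Phi> (F - G) \<oplus>\<^bsub>hahn_ring R\<^esub> \<Phi> G" unfolding \<Phi>_plus[symmetric] by simp
  moreover have "\<Phi> F \<in> carrier (hahn_ring R)" for F by (simp add: \<Phi>_carrier)
  ultimately show ?thesis by (metis H.add.inv_solve_right a_minus_def)
qed

end

locale prime_ring_coding = ring_coding R \<rho> + prime_torsion_free p "TYPE('a)"
  for R :: "('r, 'm) ring_scheme" (structure) and \<rho> :: "'a::comm_ring_1 \<Rightarrow> 'r" and p :: nat
begin

text \<open>Two partial sums with at least \<open>m\<close> terms differ by a multiple of $p^m$, so convergence to zero is
  already decided by the \<open>m\<close>-th partial sum modulo $p^m$.\<close>

lemma psum_tendsto_iff: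
  "padic_tendsto R p (\<lambda>m. \<rho> (psum p F q k m)) \<zero> \<longleftrightarrow> (\<forall>m. of_nat p ^ m dvd psum p F q k m)"
proof -
  have "padic_tendsto R p (\<lambda>m. \<rho> (psum p F q k m)) \<zero>
      \<longleftrightarrow> (\<forall>m. \<exists>N. \<forall>n\<ge>N. of_nat (p ^ m) dvd psum p F q k n)"
    unfolding padic_tendsto_def dvd_iff by (simp add: a_minus_def)
  also have "\<dots> \<longleftrightarrow> (\<forall>m. of_nat p ^ m dvd psum p F q k m)"
  proof (intro iffI allI)
    fix m
    assume "\<forall>m. \<exists>N. \<forall>n\<ge>N. of_nat (p ^ m) dvd psum p F q k n"
    then obtain N where "\<forall>n\<ge>N. of_nat (p ^ m) dvd psum p F q k n" by blast
    then have "of_nat p ^ m dvd psum p F q k (m + N)" by simp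
    then show "of_nat p ^ m dvd psum p F q k m"
      unfolding psum_split by (simp only: dvd_add_left_iff dvd_triv_left)
  next
    fix m
    assume *: "\<forall>m. of_nat p ^ m dvd psum p F q k m"
    have "of_nat (p ^ m) dvd psum p F q k n" if "n \<ge> m" for n
    proof -
      have n: "n = m + (n - m)" using that by simp
      show ?thesis using * by (subst n, subst psum_split) simp
    qed
    then show "\<exists>N. \<forall>n\<ge>N. of_nat (p ^ m) dvd psum p F q k n" by blast
  qed
  finally show ?thesis .
qed

lemma \<Phi>_in_hahn_null_iff: "\<Phi> F \<in> hahn_null R p \<longleftrightarrow> F \<in> null_hahn p"
proof -
  have "(\<Oplus>j\<in>{..<M}. add_pow R (p ^ j) (\<Phi> F (q + of_int (k + int j)))) = \<rho> (psum p F q k M)" for q k M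
    by (simp add: psum_def sum \<Phi>_def of_nat_times[symmetric])
  then show ?thesis
    by (simp add: hahn_null_def null_hahn_def \<Phi>_carrier psum_tendsto_iff vanishes_below_def)
      (simp add: \<Phi>_def)
qed

lemma ideal_hahn_null: "ideal (hahn_null R p) (hahn_ring R)"
proof -
  interpret H: cring "hahn_ring R" by (rule cring_hahn_ring)
  have sub: "hahn_null R p \<subseteq> range \<Phi>" unfolding hahn_null_def \<Phi>_carrier by blast
  have mult: "x \<otimes>\<^bsub>hahn_ring R\<^esub> a \<in> hahn_null R p"
    if a: "a \<in> hahn_null R p" "x \<in> carrier (hahn_ring R)" for a x
  proof -
    obtain F G where "a = \<Phi> F" "x = \<Phi> G" using a sub unfolding \<Phi>_carrier by blast
    then show ?thesis
      using a(1) by (simp add: \<Phi>_times[symmetric] \<Phi>_in_hahn_null_iff null_hahn_mult)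
  qed
  show ?thesis
  proof (rule idealI)
    show "ring (hahn_ring R)" by (rule H.ring_axioms)
    show "subgroup (hahn_null R p) (add_monoid (hahn_ring R))"
    proof (rule H.add.subgroupI)
      show "hahn_null R p \<subseteq> carrier (hahn_ring R)" using sub by (simp add: \<Phi>_carrier)
      show "hahn_null R p \<noteq> {}" using \<Phi>_in_hahn_null_iff[of 0] null_hahn_zero by blast
      show "\<ominus>\<^bsub>hahn_ring R\<^esub> a \<in> hahn_null R p" if a: "a \<in> hahn_null R p" for a
      proof -
        obtain F where F: "a = \<Phi> F" using a sub by blast
        have "\<Phi> (0 - F) \<in> hahn_null R p"
          using a unfolding F \<Phi>_in_hahn_null_iff by (intro null_hahn_diff null_hahn_zero)
        moreover have "\<Phi> F \<in> carrier (hahn_ring R)" by (simp add: \<Phi>_carrier)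
        ultimately show ?thesis
          by (simp only: \<Phi>_minus \<Phi>_zero F H.minus_eq H.l_zero H.a_inv_closed)
      qed
      show "a \<oplus>\<^bsub>hahn_ring R\<^esub> b \<in> hahn_null R p" if a: "a \<in> hahn_null R p" "b \<in> hahn_null R p" for a b
      proof -
        obtain F G where "a = \<Phi> F" "b = \<Phi> G" using a sub by blast
        then show ?thesis
          using a by (simp add: \<Phi>_plus[symmetric] \<Phi>_in_hahn_null_iff null_hahn_add)
      qed
    qed
  next
    fix a x assume *: "a \<in> hahn_null R p" "x \<in> carrier (hahn_ring R)"
    then show "x \<otimes>\<^bsub>hahn_ring R\<^esub> a \<in> hahn_null R p" by (rule mult)
    moreover have "a \<in> carrier (hahn_ring R)" using * sub by (auto simp: \<Phi>_carrier)
    ultimately show "a \<otimes>\<^bsub>hahn_ring R\<^esub> x \<in> hahn_null R p" using * H.m_comm by simp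
  qed
qed

lemma ring_padic_hahn: "ring (padic_hahn R p)"
  unfolding padic_hahn_def by (rule ideal.quotient_is_ring[OF ideal_hahn_null])

text \<open>The map \<open>\<theta>\<close> is a ring homomorphism with kernel \<open>null_hahn\<close>, so equations in the quotient can be
  pulled back along it.\<close>

definition \<theta> :: "'a hahn \<Rightarrow> (rat \<Rightarrow> 'r) set" where
  "\<theta> F = padic_hahn_class R p (\<Phi> F)"

lemma class_ring_hom: "(+>\<^bsub>hahn_ring R\<^esub>) (hahn_null R p) \<in> Ring.ring_hom (hahn_ring R) (padic_hahn R p)"
  unfolding padic_hahn_def by (rule ideal.rcos_ring_hom[OF ideal_hahn_null])

lemma \<theta>_plus: "\<theta> (F + G) = \<theta> F \<oplus>\<^bsub>padic_hahn R p\<^esub> \<theta> G"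
  unfolding \<theta>_def padic_hahn_class_def \<Phi>_plus
  by (rule ring_hom_add[OF class_ring_hom]) (simp_all add: \<Phi>_carrier)

lemma \<theta>_times: "\<theta> (F * G) = \<theta> F \<otimes>\<^bsub>padic_hahn R p\<^esub> \<theta> G"
  unfolding \<theta>_def padic_hahn_class_def \<Phi>_times
  by (rule ring_hom_mult[OF class_ring_hom]) (simp_all add: \<Phi>_carrier)

lemma \<theta>_one: "\<theta> 1 = \<one>\<^bsub>padic_hahn R p\<^esub>"
  unfolding \<theta>_def padic_hahn_class_def \<Phi>_one
  by (rule ring_hom_one[OF class_ring_hom])

lemma \<theta>_zero: "\<theta> 0 = \<zero>\<^bsub>padic_hahn R p\<^esub>"
  unfolding \<theta>_def padic_hahn_class_def \<Phi>_zero
  by (rule ring_hom_zero[OF class_ring_hom]) (simp_all add: cring.axioms cring_hahn_ring ring_padic_hahn)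

lemma \<theta>_power: "\<theta> (F ^ n) = \<theta> F [^]\<^bsub>padic_hahn R p\<^esub> n"
proof (induction n)
  case (Suc n)
  show ?case unfolding power_Suc2 \<theta>_times Suc by (simp add: nat_pow_def)
qed (simp add: \<theta>_one nat_pow_def)

lemma \<theta>_eq_iff: "\<theta> F = \<theta> G \<longleftrightarrow> F - G \<in> null_hahn p"
proof -
  interpret H: cring "hahn_ring R" by (rule cring_hahn_ring)
  have "\<Phi> F \<in> carrier (hahn_ring R)" for F by (simp add: \<Phi>_carrier)
  from H.quotient_eq_iff_same_a_r_cos[OF ideal_hahn_null this this]
  show ?thesis
    unfolding \<theta>_def padic_hahn_class_def \<Phi>_in_hahn_null_iff[symmetric] \<Phi>_minus by blast
qed

lemma \<theta>_A: "\<theta> (neg_power_series p) = padic_A R p"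
proof -
  have "\<Phi> (neg_power_series p) = hahn_A R p"
    by (auto simp: \<Phi>_def hahn_A_def hcoeff_neg_power_series[OF p_ge_2] fun_eq_iff zero one)
  then show ?thesis by (simp add: \<theta>_def padic_A_def)
qed

lemma padic_rational_lift:
  assumes "c \<in> padic_rationals R p"
  shows "\<exists>h. integral_support h \<and> \<theta> h = c"
proof -
  obtain x n where c: "c = padic_hahn_class R p (hahn_monom R x (- of_nat n))"
    and x: "x \<in> padic_integers R p"
    using assms unfolding padic_rationals_def by blast
  obtain w where w: "x = \<rho> w" using x unfolding padic_integers_def range[symmetric] by blast
  have "\<Phi> (hmonom w (- of_nat n)) = hahn_monom R x (- of_nat n)"
    by (auto simp: \<Phi>_def hahn_monom_def w zero fun_eq_iff)
  then have "\<theta> (hmonom w (- of_nat n)) = c" by (simp add: \<theta>_def c)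
  moreover have "integral_support (hmonom w (- of_nat n))"
    by (simp add: integral_support_def)
  ultimately show ?thesis by blast
qed

definition lift :: "(rat \<Rightarrow> 'r) set \<Rightarrow> 'a hahn" where
  "lift c = (SOME h. integral_support h \<and> \<theta> h = c)"

lemma lift:
  assumes "c \<in> padic_rationals R p"
  shows "integral_support (lift c)" "\<theta> (lift c) = c"
  using someI_ex[OF padic_rational_lift[OF assms]] unfolding lift_def by auto

text \<open>Coefficient lists start with the leading coefficient, hence the reversal.\<close>

definition lift_coeff :: "(rat \<Rightarrow> 'r) set list \<Rightarrow> nat \<Rightarrow> 'a hahn" where
  "lift_coeff P i = (if i < length P then lift (rev P ! i) else 0)"

lemma eval_lift:
  assumes "set P \<subseteq> padic_rationals R p" "length P \<le> n"
  shows "ring.eval (padic_hahn R p) P (\<theta> F) = \<theta> (\<Sum>i<n. lift_coeff P i * F ^ i)"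
proof -
  interpret Q: ring "padic_hahn R p" by (rule ring_padic_hahn)
  have "(\<Sum>i<n. lift_coeff P i * F ^ i) = (\<Sum>i<length P. lift_coeff P i * F ^ i)"
    using assms(2) by (intro sum.mono_neutral_right) (auto simp: lift_coeff_def)
  also have "\<theta> \<dots> = Q.eval P (\<theta> F)"
    using assms(1)
  proof (induction P)
    case (Cons c P)
    have "lift_coeff (c # P) i = lift_coeff P i" if "i < length P" for i
      using that by (simp add: lift_coeff_def nth_append)
    moreover have "lift_coeff (c # P) (length P) = lift c"
      by (simp add: lift_coeff_def nth_append)
    ultimately have "(\<Sum>i<length (c # P). lift_coeff (c # P) i * F ^ i)
        = lift c * F ^ length P + (\<Sum>i<length P. lift_coeff P i * F ^ i)"
      by (simp add: add.commute)
    then show ?case using Cons lift(2) by (simp add: \<theta>_plus \<theta>_times \<theta>_power)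
  qed (simp add: \<theta>_zero)
  finally show ?thesis ..
qed

text \<open>The values of two polynomials at the series lift to combinations of its powers. If the values are
  equal, the difference of the combinations is null, so by \<open>null_if_power_sum_null\<close>
  corresponding coefficients have the same image. As leading coefficients are nonzero, the lists
  then also have the same length.\<close>

lemma padic_A_transcendental:
  "(ring.transcendental (padic_hahn R p) over padic_rationals R p) (padic_A R p)"
proof -
  interpret Q: ring "padic_hahn R p" by (rule ring_padic_hahn)
  let ?K = "padic_rationals R p"
  let ?A = "neg_power_series p :: 'a hahn"
  have lift_coeff_int: "integral_support (lift_coeff P i)" if "set P \<subseteq> ?K" for P i
  proof (cases "i < length P")
    case True
    then have "rev P ! i \<in> ?K" using that nth_mem[of i "rev P"] by auto
    then show ?thesis using True by (simp add: lift_coeff_def lift(1))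
  qed (simp add: lift_coeff_def integral_support_def)
  have \<theta>_lift_coeff: "\<theta> (lift_coeff P i) = rev P ! i" if "set P \<subseteq> ?K" "i < length P" for P i
  proof -
    have "rev P ! i \<in> ?K" using that nth_mem[of i "rev P"] by auto
    then show ?thesis using that(2) by (simp add: lift_coeff_def lift(2))
  qed
  have length_le: "length P' \<le> length P"
    if eq: "\<And>i. \<theta> (lift_coeff P i) = \<theta> (lift_coeff P' i)"
      and P': "P' = [] \<or> hd P' \<noteq> \<zero>\<^bsub>padic_hahn R p\<^esub>" "set P' \<subseteq> ?K" for P P'
  proof (rule ccontr)
    assume less: "\<not> length P' \<le> length P"
    then have ne: "P' \<noteq> []" by auto
    let ?i = "length P' - 1"
    have "\<theta> (lift_coeff P' ?i) = rev P' ! ?i" using ne P'(2) by (intro \<theta>_lift_coeff) auto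
    also have "\<dots> = hd P'" using ne by (simp add: rev_nth hd_conv_nth)
    finally have "\<theta> (lift_coeff P ?i) = hd P'" by (simp add: eq)
    moreover have "lift_coeff P ?i = 0" using less by (simp add: lift_coeff_def)
    ultimately show False using P'(1) ne by (simp add: \<theta>_zero)
  qed
  have "inj_on (\<lambda>P. Q.eval P (padic_A R p)) (carrier (univ_poly (padic_hahn R p) ?K))"
  proof (rule inj_onI)
    fix P P'
    assume "P \<in> carrier (univ_poly (padic_hahn R p) ?K)" "P' \<in> carrier (univ_poly (padic_hahn R p) ?K)"
    then have poly: "P = [] \<or> hd P \<noteq> \<zero>\<^bsub>padic_hahn R p\<^esub>" "P' = [] \<or> hd P' \<noteq> \<zero>\<^bsub>padic_hahn R p\<^esub>"
      and K: "set P \<subseteq> ?K" "set P' \<subseteq> ?K"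
      unfolding univ_poly_def polynomial_def by auto
    assume eval_eq: "Q.eval P (padic_A R p) = Q.eval P' (padic_A R p)"
    define n where "n = max (length P) (length P')"
    have "\<theta> (\<Sum>i<n. lift_coeff P i * ?A ^ i) = \<theta> (\<Sum>i<n. lift_coeff P' i * ?A ^ i)"
      using eval_eq unfolding \<theta>_A[symmetric]
      by (simp only: eval_lift[OF K(1), of n] eval_lift[OF K(2), of n] n_def max.cobounded1 max.cobounded2)
    then have null_sum: "(\<Sum>i<n. (lift_coeff P i - lift_coeff P' i) * ?A ^ i) \<in> null_hahn p"
      unfolding \<theta>_eq_iff by (simp add: left_diff_distrib sum_subtractf)
    have diff_int: "integral_support (lift_coeff P i - lift_coeff P' i)" for i
      using lift_coeff_int[OF K(1), of i] lift_coeff_int[OF K(2), of i]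
      unfolding integral_support_def by force
    have "lift_coeff P i - lift_coeff P' i \<in> null_hahn p" if "i < n" for i
      by (rule null_if_power_sum_null[OF null_sum _ that]) (rule diff_int)
    then have eq: "\<theta> (lift_coeff P i) = \<theta> (lift_coeff P' i)" for i
      by (cases "i < n") (auto simp: \<theta>_eq_iff n_def lift_coeff_def null_hahn_zero)
    have len: "length P = length P'"
      using length_le[of P P'] length_le[of P' P] eq poly K by (simp add: le_antisym)
    have "rev P = rev P'"
    proof (rule nth_equalityI)
      fix i assume "i < length (rev P)"
      then show "rev P ! i = rev P' ! i"
        using \<theta>_lift_coeff[OF K(1), of i] \<theta>_lift_coeff[OF K(2), of i] eq[of i] len by simp
    qed (simp add: len)
    then show "P = P'" by simp
  qed
  then show ?thesis
    unfolding over_def Q.transcendental_def .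
qed

end


section \<open>Witt vectors over an algebraic closure of a prime field\<close>

typedef (overloaded) 'p witt = "UNIV :: (nat \<Rightarrow> 'p::prime_card mod_ring alg_closure) set"
  by simp

abbreviation witt_record :: "'p::prime_card itself \<Rightarrow> (nat \<Rightarrow> 'p mod_ring alg_closure) ring" where
  "witt_record _ \<equiv> witt_ring CARD('p)"

lemma cring_witt_record: "cring (witt_record TYPE('p::prime_card))"
  by (rule cring_witt_ring) (rule prime_card)

instantiation witt :: (prime_card) comm_ring_1
begin

definition "0 = Abs_witt \<zero>\<^bsub>witt_record TYPE('a)\<^esub>"
definition "1 = Abs_witt \<one>\<^bsub>witt_record TYPE('a)\<^esub>"
definition "x + y = Abs_witt (Rep_witt x \<oplus>\<^bsub>witt_record TYPE('a)\<^esub> Rep_witt y)"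
definition "x * y = Abs_witt (Rep_witt x \<otimes>\<^bsub>witt_record TYPE('a)\<^esub> Rep_witt y)"
definition "- x = Abs_witt (\<ominus>\<^bsub>witt_record TYPE('a)\<^esub> Rep_witt x)"
definition "x - y = Abs_witt (Rep_witt x \<ominus>\<^bsub>witt_record TYPE('a)\<^esub> Rep_witt y)"

lemmas witt_ring_defs = zero_witt_def one_witt_def plus_witt_def times_witt_def
  uminus_witt_def minus_witt_def

instance
proof -
  interpret W: cring "witt_record TYPE('a)" by (rule cring_witt_record)
  have "\<zero>\<^bsub>witt_record TYPE('a)\<^esub> 0 \<noteq> \<one>\<^bsub>witt_record TYPE('a)\<^esub> 0"
    by (simp add: witt_zero_eq witt_one_eq)
  then have "\<zero>\<^bsub>witt_record TYPE('a)\<^esub> \<noteq> \<one>\<^bsub>witt_record TYPE('a)\<^esub>" by metis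
  then show "OFCLASS('a witt, comm_ring_1_class)"
    by intro_classes
      (simp_all add: witt_ring_defs Abs_witt_inverse Abs_witt_inject Rep_witt_inverse
        W.a_ac W.m_ac W.l_distr W.r_distr W.l_neg W.r_neg W.minus_eq)
qed

end

lemma ring_coding_witt: "ring_coding (witt_record TYPE('p::prime_card)) (Rep_witt :: 'p witt \<Rightarrow> _)"
proof -
  interpret W: cring "witt_record TYPE('p)" by (rule cring_witt_record)
  show ?thesis
  proof
    show "inj (Rep_witt :: 'p witt \<Rightarrow> _)" by (auto simp: inj_def Rep_witt_inject)
    show "range (Rep_witt :: 'p witt \<Rightarrow> _) = carrier (witt_record TYPE('p))"
      by (metis Abs_witt_inverse UNIV_I surjI witt_carrier)
  qed (simp_all add: witt_ring_defs Abs_witt_inverse)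
qed

lemma prime_torsion_free_witt: "prime_torsion_free TYPE('p::prime_card witt) CARD('p)"
proof
  show p: "prime CARD('p)" by (rule prime_card)
  interpret coding: ring_coding "witt_record TYPE('p)" "Rep_witt :: 'p witt \<Rightarrow> _"
    by (rule ring_coding_witt)
  fix x :: "'p witt"
  assume "of_nat CARD('p) * x = 0"
  then have "Rep_witt (of_nat CARD('p) * x) = Rep_witt 0" by simp
  then have zero: "add_pow (witt_record TYPE('p)) CARD('p) (Rep_witt x) = (\<lambda>n. 0)"
    unfolding coding.of_nat_times coding.zero witt_zero_eq .
  have char: "of_nat CARD('p) = (0 :: 'p mod_ring alg_closure)"
    by (metis of_nat_card_eq_0 CARD_mod_ring to_ac_0 to_ac_of_nat)
  have "Rep_witt x n ^ CARD('p) = 0" for n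
    using witt_p_times[OF p char, of "Rep_witt x" n] by (simp add: zero)
  then have "Rep_witt x = Rep_witt 0"
    unfolding coding.zero witt_zero_eq by (simp add: fun_eq_iff)
  then show "x = 0" by (simp add: Rep_witt_inject)
qed

theorem theorem2:
  fixes p :: nat and W :: "(nat \<Rightarrow> 'p::prime_card mod_ring alg_closure) ring"
  assumes "p = CARD('p)" and "W = witt_ring p"
  shows "(ring.transcendental (padic_hahn W p) over padic_rationals W p) (padic_A W p)"
proof -
  interpret prime_ring_coding "witt_record TYPE('p)" "Rep_witt :: 'p witt \<Rightarrow> _" "CARD('p)"
    by (rule prime_ring_coding.intro[OF ring_coding_witt prime_torsion_free_witt])
  show ?thesis unfolding assms by (rule padic_A_transcendental)
qed

end
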